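(* The $J$-order on $\mathrm{Styl}(A)$ is graded, and the co-rank of an element $m=\mu(w)$ ($w\in A^*$) is the number of boxes in its $N$-tableau $N(w)$.
   Context: $A$ is a finite totally ordered alphabet. A column is a subset of $A$, identified with the strictly decreasing word of its elements. For a column $\gamma$ and a letter $x$: if $x>y$ for all $y\in\gamma$, $x\cdot\gamma=\gamma\cup\{x\}$; otherwise with $y$ the smallest element of $\gamma$ with $y\geq x$, $x\cdot\gamma=(\gamma\setminus\{y\})\cup\{x\}$; this extends to a left action of $A^*$ on columns by $(uv)\cdot\gamma=u\cdot(v\cdot\gamma)$. $\mathrm{Styl}(A)$ is the monoid of maps on columns induced by words, $\mu:A^*\to\mathrm{Styl}(A)$ the canonical surjection. $\mathrm{Styl}(A)$ is $J$-trivial and its $J$-order is $u\leq_J v$ iff $u\in \mathrm{Styl}(A)\,v\,\mathrm{Styl}(A)$; it has a minimum (the zero) and a maximum (the identity). A finite poset $P$ is graded if there is $\mathrm{rk}:P\to\mathbb N$ with $x<y\Rightarrow \mathrm{rk}(x)<\mathrm{rk}(y)$ and $\mathrm{rk}(y)=\mathrm{rk}(x)+1$ whenever $y$ covers $x$; with minimum $\hat0$, maximum $\hat1$ and normalization $\mathrm{rk}(\hat0)=0$, the co-rank is $x\mapsto \mathrm{rk}(\hat1)-\mathrm{rk}(x)$. Tableaux are in French convention. $N$-insertion of $x$ into a strictly increasing row $B$ gives $B\cup\{x\}$ and bumps a copy of the smallest element of $B$ strictly larger than $x$, if one exists; $N$-insertion into a tableau inserts into row 1, then the bumped letter into row 2,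 etc. For $w=a_1\cdots a_n$, $N(w)$ is obtained from the empty tableau by $N$-inserting $a_1,\ldots,a_n$ successively; $N(w)$ depends only on $\mu(w)$. *)

theory Defs
  imports "HOL-Algebra.Group"
begin

definition letter_act :: "'a::linorder \<Rightarrow> 'a set \<Rightarrow> 'a set" where
  "letter_act x \<gamma> =
    (if \<forall>y\<in>\<gamma>. y < x then insert x \<gamma>
     else insert x (\<gamma> - {Min {y \<in> \<gamma>. x \<le> y}}))"

text \<open>The rightmost letter of a word acts first.\<close>

definition word_act :: "'a::linorder list \<Rightarrow> 'a set \<Rightarrow> 'a set" where
  "word_act w \<gamma> = foldr letter_act w \<gamma>"

text \<open>
  The columns over the alphabet \<open>A\<close> are the members of \<open>Pow A\<close>. The map induced by a word
  is restricted to \<open>Pow A\<close>, so that two words inducing the same map on the columns over \<open>A\<close>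
  give equal functions.
\<close>

definition styl_map :: "'a::linorder set \<Rightarrow> 'a list \<Rightarrow> 'a set \<Rightarrow> 'a set" where
  "styl_map A w = restrict (word_act w) (Pow A)"

definition Styl :: "'a::linorder set \<Rightarrow> ('a set \<Rightarrow> 'a set) monoid" where
  "Styl A =
    \<lparr>carrier = styl_map A ` lists A,
     mult = compose (Pow A),
     one = restrict id (Pow A)\<rparr>"

definition J_order :: "('m, 'b) monoid_scheme \<Rightarrow> ('m \<times> 'm) set" where
  "J_order M = {(u, v). u \<in> carrier M \<and> v \<in> carrier M \<and>
    (\<exists>s\<in>carrier M. \<exists>t\<in>carrier M. u = s \<otimes>\<^bsub>M\<^esub> v \<otimes>\<^bsub>M\<^esub> t)}"

definition below :: "('p \<times> 'p) set \<Rightarrow> 'p \<Rightarrow> 'p \<Rightarrow> bool" where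
  "below r x y \<longleftrightarrow> (x, y) \<in> r \<and> x \<noteq> y"

definition covers :: "'p set \<Rightarrow> ('p \<times> 'p) set \<Rightarrow> 'p \<Rightarrow> 'p \<Rightarrow> bool" where
  "covers P r y x \<longleftrightarrow> below r x y \<and> \<not> (\<exists>z\<in>P. below r x z \<and> below r z y)"

definition rank_function :: "'p set \<Rightarrow> ('p \<times> 'p) set \<Rightarrow> ('p \<Rightarrow> nat) \<Rightarrow> bool" where
  "rank_function P r rk \<longleftrightarrow>
    (\<forall>x\<in>P. \<forall>y\<in>P. below r x y \<longrightarrow> rk x < rk y) \<and>
    (\<forall>x\<in>P. \<forall>y\<in>P. covers P r y x \<longrightarrow> rk y = rk x + 1)"

definition graded_poset :: "'p set \<Rightarrow> ('p \<times> 'p) set \<Rightarrow> bool" where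
  "graded_poset P r \<longleftrightarrow> finite P \<and> partial_order_on P r \<and> (\<exists>rk. rank_function P r rk)"

definition poset_min :: "'p set \<Rightarrow> ('p \<times> 'p) set \<Rightarrow> 'p" where
  "poset_min P r = (THE z. z \<in> P \<and> (\<forall>x\<in>P. (z, x) \<in> r))"

definition poset_max :: "'p set \<Rightarrow> ('p \<times> 'p) set \<Rightarrow> 'p" where
  "poset_max P r = (THE e. e \<in> P \<and> (\<forall>x\<in>P. (x, e) \<in> r))"

text \<open>
  In a finite poset with a minimum, the values of a normalized rank function on \<open>P\<close> are
  unique, so the choice below only affects arguments outside \<open>P\<close>.
\<close>

definition poset_rank :: "'p set \<Rightarrow> ('p \<times> 'p) set \<Rightarrow> 'p \<Rightarrow> nat" where
  "poset_rank P r = (SOME rk. rank_function P r rk \<and> rk (poset_min P r) = 0)"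

definition corank :: "'p set \<Rightarrow> ('p \<times> 'p) set \<Rightarrow> 'p \<Rightarrow> int" where
  "corank P r x = int (poset_rank P r (poset_max P r)) - int (poset_rank P r x)"

text \<open>
  A tableau is the list of its rows, row 1 (the bottom row, in French convention) first;
  a strictly increasing row is represented by the set of its entries.
\<close>

fun N_insert :: "'a::linorder \<Rightarrow> 'a set list \<Rightarrow> 'a set list" where
  "N_insert x [] = [{x}]"
| "N_insert x (B # T) =
    insert x B # (if \<exists>y\<in>B. x < y then N_insert (Min {y \<in> B. x < y}) T else T)"

definition N_tableau :: "'a::linorder list \<Rightarrow> 'a set list" where
  "N_tableau w = foldl (\<lambda>T x. N_insert x T) [] w"

definition num_boxes :: "'a set list \<Rightarrow> nat" where
  "num_boxes T = sum_list (map card T)"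

end

theory Submission
  imports Defs
begin

text \<open>
  Identify \<open>A\<close> with \<open>{0..<n}\<close> and attach to a word \<open>w\<close> the profile \<open>D a b\<close>, the length of a
  longest strictly decreasing subword of \<open>w\<close> with letters in \<open>[a, b)\<close>. Profiles multiply in the
  max-plus sense, and \<open>w \<cdot> \<gamma>\<close> has \<open>max\<^sub>c (D c b + |\<gamma> \<inter> [0, c)|)\<close> letters below \<open>b\<close>, so that
  two words act equally iff their profiles agree. A letter \<open>y\<close> lies in row \<open>i + 1\<close> of \<open>N(w)\<close> iff
  \<open>D a (y + 1) = i + 1\<close> and \<open>D a y = i\<close> for some \<open>a\<close>; hence the boxes correspond to the corners of
  the level sets of \<open>D\<close>, a description that is symmetric under reversing both the words and the
  alphabet. Profiles have unit steps and satisfy a Monge inequality. This implies that multiplying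
  by a letter either fixes the profile or adds boxes, and that exactly one box is added
  when the multiplication is a cover of the \<open>J\<close>-order.
\<close>

section \<open>Profiles\<close>

definition ext_right :: "nat \<Rightarrow> (nat \<Rightarrow> nat \<Rightarrow> nat) \<Rightarrow> nat \<Rightarrow> nat \<Rightarrow> nat" where
  "ext_right x D a b =
    (if a \<le> x \<and> x < b then max (D a b) (Suc (D (Suc x) b)) else D a b)"

definition ext_left :: "nat \<Rightarrow> (nat \<Rightarrow> nat \<Rightarrow> nat) \<Rightarrow> nat \<Rightarrow> nat \<Rightarrow> nat" where
  "ext_left x D a b =
    (if a \<le> x \<and> x < b then max (D a b) (Suc (D a x)) else D a b)"

text \<open>
  \<open>ext_left x\<close> and \<open>ext_right x\<close> turn the profile of \<open>w\<close> into those of \<open>x w\<close> and \<open>w x\<close>: a decreasing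
  subword using the new letter has all its other letters below, respectively above, \<open>x\<close>.
\<close>

definition decr :: "nat list \<Rightarrow> nat \<Rightarrow> nat \<Rightarrow> nat" where
  "decr w = foldr ext_left w (\<lambda>_ _. 0)"

lemma decr_Nil: "decr [] = (\<lambda>_ _. 0)"
  by (simp add: decr_def)

lemma decr_Cons: "decr (x # w) = ext_left x (decr w)"
  by (simp add: decr_def)

text \<open>A decreasing subword of \<open>y w x\<close> can use both new letters exactly when
  \<open>x < y\<close>; both sides then offer the same extra candidate
  \<open>D (Suc x) y + 2\<close>. This lets words grow at either end although \<open>decr\<close> is
  defined from the left.\<close>

lemma ext_left_ext_right: "ext_left y (ext_right x D) = ext_right x (ext_left y D)"
  by (intro ext) (auto simp: ext_left_def ext_right_def max_def)

lemma decr_snoc: "decr (w @ [x]) = ext_right x (decr w)"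
proof (induction w)
  case Nil
  show ?case
    by (intro ext) (simp add: decr_Nil decr_Cons ext_left_def ext_right_def)
next
  case (Cons y w)
  then show ?case by (simp add: decr_Cons ext_left_ext_right)
qed

lemma decr_append_left: "decr (u @ v) = foldr ext_left u (decr v)"
  by (simp add: decr_def)

lemma decr_append_right: "decr (u @ v) = foldl (\<lambda>D x. ext_right x D) (decr u) v"
proof (induction v arbitrary: u)
  case (Cons x v)
  from Cons[of "u @ [x]"] show ?case by (simp add: decr_snoc)
qed simp

text \<open>Equality of profiles is a congruence: \<open>t\<close> acts from the right,
  \<open>s\<close> from the left, and both actions see only the profile.\<close>

lemma decr_cong:
  assumes "decr u = decr v"
  shows "decr (s @ u @ t) = decr (s @ v @ t)"
  using assms by (simp add: decr_append_left[of s] decr_append_right[of _ t])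

text \<open>Stated for an abstract \<open>D\<close> so that every result also applies to the
  mirrored profile \<open>opp n D\<close>. The Monge inequality says that the gain from extending an
  interval to the left does not increase when its right end grows.\<close>

locale profile =
  fixes n :: nat and D :: "nat \<Rightarrow> nat \<Rightarrow> nat"
  assumes zero: "b \<le> a \<Longrightarrow> D a b = 0"
    and left_mono: "D (Suc a) b \<le> D a b"
    and left_unit: "D a b \<le> Suc (D (Suc a) b)"
    and right_mono: "D a b \<le> D a (Suc b)"
    and right_unit: "D a (Suc b) \<le> Suc (D a b)"
    and monge: "\<lbrakk>a \<le> a'; a' \<le> b; b \<le> b'\<rbrakk> \<Longrightarrow> D a b' + D a' b \<le> D a b + D a' b'"
    and stable: "n \<le> b \<Longrightarrow> D a b = D a n"
begin

lemma mono: "a' \<le> a \<Longrightarrow> b \<le> b' \<Longrightarrow> D a b \<le> D a' b'"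
proof -
  assume "a' \<le> a" "b \<le> b'"
  have "D a b \<le> D a' b"
    using \<open>a' \<le> a\<close> by (rule lift_Suc_antimono_le[of "\<lambda>a. D a b", OF left_mono])
  also have "\<dots> \<le> D a' b'"
    using \<open>b \<le> b'\<close> by (rule lift_Suc_mono_le[of "D a'", OF right_mono])
  finally show ?thesis .
qed

text \<open>By the Monge inequality \<open>D a b - D a' b\<close> cannot increase with
  \<open>b\<close>, and it is never negative; once zero, it stays zero.\<close>

lemma eq_propagates:
  assumes "D a b = D a' b" "a \<le> a'" "a' \<le> b" "b \<le> b'"
  shows "D a b' = D a' b'"
  using monge[OF assms(2-4)] mono[of a a' b' b'] assms by simp

lemma le_right_plus_diff: "a \<le> b \<Longrightarrow> D a c + a \<le> D b c + b"
proof (induction b rule: dec_induct)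
  case (step k)
  then show ?case using left_unit[of k c] by simp
qed simp

lemma profile_ext_right:
  assumes "x < n"
  shows "profile n (ext_right x D)"
proof
  fix a b show "b \<le> a \<Longrightarrow> ext_right x D a b = 0" by (auto simp: ext_right_def zero)
next
  fix a b
  show "ext_right x D (Suc a) b \<le> ext_right x D a b"
    using left_mono[of a b] mono[of "Suc a" "Suc x" b b] by (auto simp: ext_right_def)
  show "ext_right x D a b \<le> Suc (ext_right x D (Suc a) b)"
    using left_unit[of a b] by (cases "a = x") (auto simp: ext_right_def)
  show "ext_right x D a b \<le> ext_right x D a (Suc b)"
    using right_mono[of a b] right_mono[of "Suc x" b] by (auto simp: ext_right_def)
  show "ext_right x D a (Suc b) \<le> Suc (ext_right x D a b)"
    using right_unit[of a b] right_unit[of "Suc x" b] zero[of "Suc x" "Suc x"]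
    by (cases "b = x") (auto simp: ext_right_def)
next
  fix a a' b b' assume ord: "a \<le> a'" "a' \<le> b" "b \<le> (b'::nat)"
  note m = monge[OF ord]
  \<comment> \<open>The cases sort the intervals containing \<open>x\<close>: none, the two starting
    at \<open>a\<close>, all four, the two ending at \<open>b'\<close>. Where the Monge inequality
    is needed again, \<open>Suc x\<close> replaces a left end.\<close>
  consider "x < a \<or> b' \<le> x" | "a \<le> x" "x < a'" | "a' \<le> x" "x < b" | "a' \<le> x" "b \<le> x" "x < b'"
    by linarith
  then show "ext_right x D a b' + ext_right x D a' b \<le> ext_right x D a b + ext_right x D a' b'"
  proof cases
    case 1
    then show ?thesis using ord m by (auto simp: ext_right_def)
  next
    case 2
    then have "D (Suc x) b' + D a' b \<le> D (Suc x) b + D a' b'"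
      using ord by (intro monge) auto
    with 2 ord m show ?thesis by (auto simp: ext_right_def max_def)
  next
    case 3
    then have "D a b' + D (Suc x) b \<le> D a b + D (Suc x) b'"
      using ord by (intro monge) auto
    moreover have "D a' b \<le> D a b" using ord by (intro mono) auto
    ultimately show ?thesis using 3 ord m by (auto simp: ext_right_def max_def)
  next
    case 4
    moreover have "D a' b \<le> D a b" using ord by (intro mono) auto
    ultimately show ?thesis using ord m by (auto simp: ext_right_def max_def)
  qed
next
  fix a b assume "n \<le> b"
  then show "ext_right x D a b = ext_right x D a n"
    using assms stable[of b a] stable[of b "Suc x"] by (auto simp: ext_right_def)
qed

end

lemma profile_decr:
  assumes "set w \<subseteq> {..<n}"
  shows "profile n (decr w)"
  using assms
proof (induction w rule: rev_induct)
  case Nil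
  show ?case by unfold_locales (auto simp: decr_Nil)
next
  case (snoc x w)
  then show ?case by (simp add: decr_snoc profile.profile_ext_right)
qed

section \<open>Boxes and corners\<close>

text \<open>
  \<open>(y, i) \<in> steps D\<close> says that \<open>y\<close> is in row \<open>i\<close> (counted from \<open>0\<close>) of the \<open>N\<close>-tableau, and
  \<open>(y, i) \<in> bump x D\<close> that the \<open>N\<close>-insertion of \<open>x\<close> puts \<open>y\<close> into row \<open>i\<close>.
\<close>

definition steps :: "(nat \<Rightarrow> nat \<Rightarrow> nat) \<Rightarrow> (nat \<times> nat) set" where
  "steps D = {(y, i). \<exists>a. D a (Suc y) = Suc i \<and> D a y = i}"

definition bump :: "nat \<Rightarrow> (nat \<Rightarrow> nat \<Rightarrow> nat) \<Rightarrow> (nat \<times> nat) set" where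
  "bump x D = insert (x, 0) {(y, Suc i) |y i. D (Suc x) (Suc y) = Suc i \<and> D (Suc x) y = i}"

text \<open>\<open>(a, b)\<close> stands for the interval \<open>[a, b + 1)\<close>. For a profile
  these are the inclusion-minimal intervals of their level set, a description that reversal
  preserves, whereas \<open>steps\<close> singles out the right end.\<close>

definition corners :: "(nat \<Rightarrow> nat \<Rightarrow> nat) \<Rightarrow> (nat \<times> nat) set" where
  "corners D = {(a, b). D a (Suc b) = Suc (D (Suc a) (Suc b)) \<and> D a (Suc b) = Suc (D a b)}"

context profile
begin

text \<open>Monotonicity turns the maximum into a test: \<open>x\<close> gains one exactly when
  raising the left end to \<open>Suc x\<close> costs nothing.\<close>

lemma ext_right_eq:
  "ext_right x D a b = (if a \<le> x \<and> x < b \<and> D a b = D (Suc x) b then Suc (D a b) else D a b)"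
proof (cases "a \<le> x \<and> x < b")
  case True
  then have "D (Suc x) b \<le> D a b" by (intro mono) auto
  with True show ?thesis by (auto simp: ext_right_def)
qed (auto simp: ext_right_def)

lemma ext_right_ge: "D a b \<le> ext_right x D a b"
  by (simp add: ext_right_eq)

lemma letter_bounds:
  assumes "D a (Suc b) = Suc (D a b)"
  shows "a \<le> b" "b < n"
proof -
  show "a \<le> b" using assms zero[of "Suc b" a] by (cases "Suc b \<le> a") auto
  show "b < n" using assms stable[of b a] stable[of "Suc b" a] by (cases "b < n") auto
qed

lemma corners_subset: "corners D \<subseteq> {(a, b). a \<le> b \<and> b < n}"
  using letter_bounds by (auto simp: corners_def)

lemma finite_corners: "finite (corners D)"
  by (rule finite_subset[of _ "{..<n} \<times> {..<n}"]) (use corners_subset in auto)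

lemma steps_fst: "(y, i) \<in> steps D \<Longrightarrow> y < n"
  using letter_bounds(2) by (auto simp: steps_def)

text \<open>
  The level set \<open>{(a, b). D a b \<ge> Suc i}\<close> is a staircase, and each \<open>y\<close> with \<open>(y, i) \<in> steps D\<close>
  determines the corner of the staircase with the largest \<open>a\<close>.
\<close>

lemma bij_corners_steps: "bij_betw (\<lambda>(a, b). (b, D a b)) (corners D) (steps D)"
proof (rule bij_betw_imageI)
  have "\<not> e < e'" if "(e, b) \<in> corners D" "(e', b) \<in> corners D" "D e b = D e' b" for e e' b
  proof
    assume "e < e'"
    then have "D e' (Suc b) \<le> D (Suc e) (Suc b)" by (intro mono) auto
    with that show False by (auto simp: corners_def)
  qed
  then show "inj_on (\<lambda>(a, b). (b, D a b)) (corners D)"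
    by (intro inj_onI) (clarsimp, metis linorder_neqE_nat)
  show "(\<lambda>(a, b). (b, D a b)) ` corners D = steps D"
  proof (intro equalityI subsetI)
    fix p assume "p \<in> (\<lambda>(a, b). (b, D a b)) ` corners D"
    then show "p \<in> steps D" by (force simp: steps_def corners_def)
  next
    fix p assume "p \<in> steps D"
    then obtain y i a where p: "p = (y, i)" and a: "D a (Suc y) = Suc i" "D a y = i"
      by (auto simp: steps_def)
    define S where "S = {a. D a (Suc y) = Suc i}"
    have "S \<subseteq> {..y}"
    proof
      fix e assume "e \<in> S"
      then show "e \<in> {..y}" using zero[of "Suc y" e] by (cases "Suc y \<le> e") (auto simp: S_def)
    qed
    then have fin: "finite S" by (rule finite_subset) simp
    define m where "m = Max S"
    have "a \<in> S" using a by (simp add: S_def)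
    then have "m \<in> S" unfolding m_def using fin by (intro Max_in) auto
    have "a \<le> m" unfolding m_def using fin \<open>a \<in> S\<close> by (rule Max_ge)
    have "Suc m \<notin> S" using Max_ge[OF fin, of "Suc m"] by (auto simp: m_def simp del: Max_ge)
    have *: "D m (Suc y) = Suc i" using \<open>m \<in> S\<close> by (simp add: S_def)
    have "D (Suc m) (Suc y) = i"
      using left_mono[of m "Suc y"] left_unit[of m "Suc y"] * \<open>Suc m \<notin> S\<close> by (auto simp: S_def)
    moreover have "D m y = i"
      using mono[OF \<open>a \<le> m\<close>, of y y] a right_unit[of m y] * by simp
    ultimately have "(m, y) \<in> corners D" "D m y = i" using * by (auto simp: corners_def)
    then show "p \<in> (\<lambda>(a, b). (b, D a b)) ` corners D" using p by force
  qed
qed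

lemma card_steps: "card (steps D) = card (corners D)"
  using bij_betw_same_card[OF bij_corners_steps] by simp

lemma finite_steps: "finite (steps D)"
  using bij_betw_finite[OF bij_corners_steps] finite_corners by simp

section \<open>Effect of right multiplication on the boxes\<close>

lemma bump_cases:
  assumes "(y, j) \<in> bump x D"
  obtains "y = x" "j = 0" | "x < y" "D (Suc x) (Suc y) = j" "Suc (D (Suc x) y) = j"
proof -
  from assms consider "y = x" "j = 0"
    | i where "j = Suc i" "D (Suc x) (Suc y) = Suc i" "D (Suc x) y = i"
    by (auto simp: bump_def)
  then show thesis
  proof cases
    case 2
    then have "x < y" using letter_bounds(1)[of "Suc x" y] by simp
    with 2 that show thesis by blast
  qed (use that in blast)
qed

text \<open>For \<open>y = x\<close> the interval \<open>[x + 1, x + 1)\<close> is empty, so the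
  formula also covers row 0.\<close>

lemma bump_level: "(y, j) \<in> bump x D \<Longrightarrow> x \<le> y \<and> D (Suc x) (Suc y) = j"
  by (erule bump_cases) (auto simp: zero)

lemma bumpI: "\<lbrakk>x < y; D (Suc x) (Suc y) = j; Suc (D (Suc x) y) = j\<rbrakk> \<Longrightarrow> (y, j) \<in> bump x D"
  by (auto simp: bump_def)

text \<open>If \<open>x\<close> does not raise the value on \<open>[a, y + 1)\<close>, the left end
  \<open>a\<close> witnesses the box before and after. If it does, \<open>Suc x\<close> takes over
  as left end, or the box is \<open>x\<close> itself in row 0.\<close>

lemma steps_ext_right:
  assumes "x < n"
  shows "steps (ext_right x D) = steps D \<union> bump x D"
proof (intro equalityI subsetI)
  interpret E: profile n "ext_right x D" using assms by (rule profile_ext_right)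
  fix p assume "p \<in> steps (ext_right x D)"
  then obtain y i a where p: "p = (y, i)"
    and a: "ext_right x D a (Suc y) = Suc i" "ext_right x D a y = i"
    by (auto simp: steps_def)
  show "p \<in> steps D \<union> bump x D"
  proof (cases "a \<le> x \<and> x \<le> y \<and> D a (Suc y) = D (Suc x) (Suc y)")
    case False
    then have "D a (Suc y) = Suc i" using a(1) by (auto simp: ext_right_eq split: if_splits)
    moreover from this have "D a y = i"
      using right_unit[of a y] ext_right_ge[of a y x] a(2) by simp
    ultimately show ?thesis using p by (auto simp: steps_def)
  next
    case True
    then have i: "D a (Suc y) = i" "D (Suc x) (Suc y) = i" using a(1) by (auto simp: ext_right_eq)
    show ?thesis
    proof (cases "x = y")
      case True
      with i zero[of "Suc y" "Suc x"] p show ?thesis by (simp add: bump_def)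
    next
      case False
      then have "Suc (D (Suc x) y) = i"
        using a(2) i True right_unit[of "Suc x" y] right_mono[of a y] mono[of a "Suc x" y y]
        by (auto simp: ext_right_eq split: if_splits)
      with i p False True bumpI show ?thesis by auto
    qed
  qed
next
  interpret E: profile n "ext_right x D" using assms by (rule profile_ext_right)
  fix p assume "p \<in> steps D \<union> bump x D"
  then show "p \<in> steps (ext_right x D)"
  proof
    assume "p \<in> steps D"
    then obtain y i a where p: "p = (y, i)" and a: "D a (Suc y) = Suc i" "D a y = i"
      by (auto simp: steps_def)
    show ?thesis
    proof (cases "a \<le> x \<and> x \<le> y \<and> D a (Suc y) = D (Suc x) (Suc y)")
      case False
      then have 1: "ext_right x D a (Suc y) = Suc i" using a by (auto simp: ext_right_eq)
      have "ext_right x D a y = i"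
      proof -
        \<comment> \<open>A gain at right end \<open>y\<close> would propagate to
          \<open>Suc y\<close>, contrary to \<open>False\<close>.\<close>
        have "\<not> (a \<le> x \<and> x < y \<and> D a y = D (Suc x) y)"
          using False eq_propagates[of a y "Suc x" "Suc y"] by auto
        then show ?thesis using a by (auto simp: ext_right_eq)
      qed
      with 1 p show ?thesis by (auto simp: steps_def)
    next
      case True
      then have "x < y" using a zero[of "Suc y" "Suc x"] by (cases "x = y") auto
      have "D (Suc x) y = i"
        using right_unit[of "Suc x" y] mono[of a "Suc x" y y] a True by simp
      then have "ext_right x D (Suc x) (Suc y) = Suc i" "ext_right x D (Suc x) y = i"
        using True a by (auto simp: ext_right_eq)
      with p show ?thesis by (auto simp: steps_def)
    qed
  next
    assume "p \<in> bump x D"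
    then obtain y j where p: "p = (y, j)" "(y, j) \<in> bump x D" by (cases p) auto
    \<comment> \<open>The left end \<open>x\<close> witnesses every box of the path: by unit steps
      the extended value there is \<open>Suc (D (Suc x) b)\<close> for \<open>b > x\<close>.\<close>
    from p(2) have "ext_right x D x (Suc y) = Suc j \<and> ext_right x D x y = j"
    proof (cases rule: bump_cases)
      case 1
      then show ?thesis
        using left_unit[of x "Suc x"] by (auto simp: ext_right_def zero)
    next
      case 2
      then show ?thesis
        using left_unit[of x y] left_unit[of x "Suc y"] by (auto simp: ext_right_def)
    qed
    with p show ?thesis by (auto simp: steps_def)
  qed
qed

text \<open>\<open>c + 1\<close> is the smallest column of the profile that is affected by \<open>x\<close>.\<close>

lemma first_change:
  assumes "x < n" "ext_right x D \<noteq> D"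
  obtains c where "x \<le> c" "c < n" "D x (Suc c) = D (Suc x) (Suc c)"
    "\<And>b. x < b \<Longrightarrow> b \<le> c \<Longrightarrow> D x b = Suc (D (Suc x) b)"
    "x < c \<Longrightarrow> Suc (D (Suc x) c) = D (Suc x) (Suc c)"
    "(c, D (Suc x) (Suc c)) \<in> bump x D - steps D"
proof -
  let ?P = "\<lambda>b. x < b \<and> D x b = D (Suc x) b"
  from assms(2) obtain a b where ab: "ext_right x D a b \<noteq> D a b" by (auto simp: fun_eq_iff)
  then have "a \<le> x" "x < b" "D a b = D (Suc x) b" by (auto simp: ext_right_eq split: if_splits)
  then have "?P b" using mono[of a x b b] left_mono[of x b] by simp
  \<comment> \<open>Values are constant in the right end beyond \<open>n\<close>, so it can be
    capped; this yields \<open>c < n\<close>.\<close>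
  then have "?P (min b n)"
    using assms(1) stable[of b x] stable[of b "Suc x"] by (auto simp: min_def)
  define b1 where "b1 = Least ?P"
  have P: "?P b1" unfolding b1_def by (rule LeastI) fact
  have "b1 \<le> min b n" unfolding b1_def by (rule Least_le) fact
  have L: "D x b' = Suc (D (Suc x) b')" if "x < b'" "b' < b1" for b'
    using not_less_Least[of b' ?P] that left_mono[of x b'] left_unit[of x b']
    by (fastforce simp: b1_def)
  obtain c where c: "b1 = Suc c" using P by (cases b1) auto
  have xc: "x \<le> c" "c < n" "D x (Suc c) = D (Suc x) (Suc c)"
    using P c \<open>b1 \<le> min b n\<close> by auto
  have L': "D x b = Suc (D (Suc x) b)" if "x < b" "b \<le> c" for b using L that c by auto
  have eq: "Suc (D (Suc x) c) = D (Suc x) (Suc c)" if "x < c"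
    using L'[of c] that xc right_mono[of x c] right_unit[of "Suc x" c] by simp
  have in_bump: "(c, D (Suc x) (Suc c)) \<in> bump x D"
  proof (cases "x = c")
    case True
    then show ?thesis by (simp add: bump_def zero)
  next
    case False
    then show ?thesis using eq xc by (intro bumpI) auto
  qed
  \<comment> \<open>A witness \<open>a\<close> of an old box here satisfies
    \<open>a \<le> x\<close>, and the Monge inequality would carry its step at \<open>c\<close> over
    to the left end \<open>x\<close>, where \<open>D\<close> is constant from \<open>c\<close> to
    \<open>Suc c\<close>.\<close>
  have "(c, D (Suc x) (Suc c)) \<notin> steps D"
  proof
    assume "(c, D (Suc x) (Suc c)) \<in> steps D"
    then obtain a where a: "D a (Suc c) = Suc (D (Suc x) (Suc c))" "D a c = D (Suc x) (Suc c)"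
      by (auto simp: steps_def)
    have "a \<le> x" using a(1) mono[of "Suc x" a "Suc c" "Suc c"] by (cases "a \<le> x") auto
    then have "D a (Suc c) + D x c \<le> D a c + D x (Suc c)" using xc by (intro monge) auto
    then show False
      using a xc eq L'[of c] zero[of "Suc c" "Suc x"] by (cases "x = c") auto
  qed
  with in_bump L' eq xc that show thesis by blast
qed

text \<open>All old boxes survive, and \<open>first_change\<close> supplies one that was not there;
  corners count the boxes.\<close>

lemma card_corners_ext_right:
  assumes "x < n" "ext_right x D \<noteq> D"
  shows "card (corners D) < card (corners (ext_right x D))"
proof -
  interpret E: profile n "ext_right x D" using assms(1) by (rule profile_ext_right)
  from first_change[OF assms] have "bump x D - steps D \<noteq> {}" by blast
  then have "steps D \<subset> steps (ext_right x D)" using steps_ext_right[OF assms(1)] by blast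
  then show "card (corners D) < card (corners (ext_right x D))"
    using psubset_card_mono[OF E.finite_steps] by (simp flip: card_steps E.card_steps)
qed

text \<open>The letter \<open>y\<close> contributes only the candidate
  \<open>Suc (D (Suc y) b)\<close>. By hypothesis \<open>x\<close> alone reaches it from left end
  \<open>y\<close>, hence by monotonicity from all smaller left ends; since \<open>y < x\<close>,
  the values at left end \<open>Suc x\<close> do not notice \<open>y\<close>.\<close>

lemma ext_right_absorb:
  assumes "x < n" "y < x" "\<And>b. y < b \<Longrightarrow> Suc (D (Suc y) b) \<le> ext_right x D y b"
  shows "ext_right x (ext_right y D) = ext_right x D"
proof (intro ext)
  fix a b
  interpret E: profile n "ext_right x D" using assms(1) by (rule profile_ext_right)
  show "ext_right x (ext_right y D) a b = ext_right x D a b"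
  proof (cases "a \<le> y \<and> y < b")
    case True
    then have "Suc (D (Suc y) b) \<le> ext_right x D a b"
      using assms(3)[of b] E.mono[of a y b b] by simp
    with True assms(2) show ?thesis by (auto simp: ext_right_def max_def split: if_splits)
  next
    case False
    then show ?thesis using assms(2) by (auto simp: ext_right_def)
  qed
qed

text \<open>
  Take \<open>x\<close> minimal. If \<open>(y, j)\<close> is a new box other than the one given by \<open>first_change\<close>, let \<open>a\<^sub>1\<close>
  be the smallest \<open>a\<close> with \<open>D a (c + 1)\<close> affected. For \<open>a\<^sub>1 > 0\<close> the letter \<open>a\<^sub>1 - 1\<close> is absorbed
  by \<open>x\<close>, so by minimality it fixes \<open>D\<close>, which makes \<open>(y, j)\<close> an old box. For \<open>a\<^sub>1 = 0\<close> left
  multiplication by \<open>c\<close> yields a profile between the two, and it adds too little at \<open>(0, y + 1)\<close>.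
\<close>

lemma cover_right:
  assumes "x < n" and ne: "ext_right x D \<noteq> D"
    and right: "\<And>y z. \<lbrakk>y < n; z < n; ext_right z (ext_right y D) = ext_right x D\<rbrakk>
      \<Longrightarrow> ext_right y D = D \<or> ext_right y D = ext_right x D"
    and left: "\<And>y. \<lbrakk>y < n; ext_left y (ext_right x D) = ext_right x D\<rbrakk>
      \<Longrightarrow> ext_left y D = D \<or> ext_left y D = ext_right x D"
  shows "card (corners (ext_right x D)) = Suc (card (corners D))"
proof -
  define x' where "x' = (LEAST z. ext_right z D = ext_right x D)"
  have x': "ext_right x' D = ext_right x D" unfolding x'_def by (rule LeastI) simp
  have "x' \<le> x" unfolding x'_def by (rule Least_le) simp
  then have "x' < n" using assms(1) by simp
  have least: "ext_right y D \<noteq> ext_right x D" if "y < x'" for y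
    using not_less_Least that unfolding x'_def by blast
  have ne': "ext_right x' D \<noteq> D" using x' ne by simp
  interpret E: profile n "ext_right x' D" using \<open>x' < n\<close> by (rule profile_ext_right)
  obtain c where c: "x' \<le> c" "c < n" "D x' (Suc c) = D (Suc x') (Suc c)"
    "\<And>b. x' < b \<Longrightarrow> b \<le> c \<Longrightarrow> D x' b = Suc (D (Suc x') b)"
    "x' < c \<Longrightarrow> Suc (D (Suc x') c) = D (Suc x') (Suc c)"
    "(c, D (Suc x') (Suc c)) \<in> bump x' D - steps D"
    using first_change[OF \<open>x' < n\<close> ne'] by metis
  let ?i = "D (Suc x') (Suc c)"
  have "bump x' D - steps D \<subseteq> {(c, ?i)}"
  proof (rule subsetI, rule ccontr)
    fix p assume "p \<in> bump x' D - steps D" "p \<notin> {(c, ?i)}"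
    then obtain y j where yj: "(y, j) \<in> bump x' D" "(y, j) \<notin> steps D" "(y, j) \<noteq> (c, ?i)"
      by (cases p) auto
    have lev: "x' \<le> y" "D (Suc x') (Suc y) = j" using bump_level[OF yj(1)] by auto
    with yj(3) have "y \<noteq> c" by auto
    then consider "y < c" | "c < y" by linarith
    then show False
    proof cases
      case 1
      then have "D x' (Suc y) = Suc j" using c(4)[of "Suc y"] lev by simp
      moreover from yj(1) have "D x' y = j"
      proof (cases rule: bump_cases)
        case 1
        then show ?thesis by (simp add: zero)
      next
        case 2
        then show ?thesis using c(4)[of y] \<open>y < c\<close> by simp
      qed
      ultimately show False using yj(2) by (auto simp: steps_def)
    next
      case 2
      then have j: "Suc (D (Suc x') y) = j" using yj(1) c(1) by (auto elim: bump_cases)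
      define a1 where "a1 = (LEAST a. D a (Suc c) = ?i)"
      have a1: "D a1 (Suc c) = ?i" unfolding a1_def by (rule LeastI) (rule c(3))
      have "a1 \<le> x'" unfolding a1_def by (rule Least_le) (rule c(3))
      have a1_eq: "D a1 b = D (Suc x') b" if "Suc c \<le> b" for b
        using eq_propagates[OF a1 _ _ that] \<open>a1 \<le> x'\<close> c(1) by simp
      show False
      proof (cases a1)
        case (Suc a0)
        then have a0: "D a0 (Suc c) \<noteq> ?i" using not_less_Least[of a0 "\<lambda>a. D a (Suc c) = ?i"] by (simp add: a1_def)
        have "Suc (D (Suc a0) b) \<le> ext_right x' D a0 b" if "a0 < b" for b
        proof (cases "D a0 b = Suc (D (Suc a0) b)")
          case True
          then show ?thesis using ext_right_ge[of a0 b x'] by simp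
        next
          case False
          then have "D a0 b = D (Suc a0) b" using left_mono[of a0 b] left_unit[of a0 b] by simp
          \<comment> \<open>Equality at some \<open>b \<le> Suc c\<close> would contradict the
            minimality of \<open>a1\<close>; beyond \<open>Suc c\<close> the left ends
            \<open>a1\<close> and \<open>Suc x'\<close> agree, and \<open>x'\<close> itself supplies
            the gain.\<close>
          then have "\<not> b \<le> Suc c"
            using eq_propagates[of a0 b "Suc a0" "Suc c"] that a0 a1 Suc by auto
          then have "D (Suc a0) b = D (Suc x') b" using a1_eq[of b] Suc by simp
          then show ?thesis
            using \<open>\<not> b \<le> Suc c\<close> \<open>a1 \<le> x'\<close> Suc c(1) by (simp add: ext_right_def)
        qed
        then have "ext_right x' (ext_right a0 D) = ext_right x D"
          using ext_right_absorb[of x' a0] \<open>x' < n\<close> \<open>a1 \<le> x'\<close> Suc x' by simp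
        \<comment> \<open>The alternative \<open>ext_right a0 D = ext_right x D\<close> is excluded
          by the minimal choice of \<open>x'\<close>, as \<open>a0 < x'\<close>.\<close>
        then have "ext_right a0 D = D"
          using right[of a0 x'] least[of a0] \<open>x' < n\<close> \<open>a1 \<le> x'\<close> Suc by auto
        then have "Suc (D a1 b) \<le> D a0 b" if "a0 < b" for b
          using that Suc ext_right_def[of a0 D a0 b] by simp
        then have full: "D a0 b = Suc (D a1 b)" if "a0 < b" for b
          using that left_unit[of a0 b] Suc by (simp add: order_antisym)
        have "D a0 (Suc y) = Suc j" "D a0 y = j"
          using full[of "Suc y"] full[of y] a1_eq[of "Suc y"] a1_eq[of y] lev j 2 c(1)
            \<open>a1 \<le> x'\<close> Suc by auto
        then show False using yj(2) by (auto simp: steps_def)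
      next
        case 0
        have flat: "D a (Suc c) = ?i" if "a \<le> x'" for a
          using mono[of 0 a "Suc c" "Suc c"] mono[of a "Suc x'" "Suc c" "Suc c"] a1 0 that by simp
        \<comment> \<open>From every left end up to \<open>c\<close> the product already steps up at
          \<open>c\<close>, so multiplying it by \<open>c\<close> on the left changes
          nothing.\<close>
        have up: "Suc (ext_right x' D a c) \<le> ext_right x' D a (Suc c)" if "a \<le> c" for a
        proof (cases "a \<le> x'")
          case True
          then have "ext_right x' D a (Suc c) = Suc ?i"
            using flat[of a] c(1) by (simp add: ext_right_eq)
          moreover have "ext_right x' D a c \<le> ?i"
            using flat[OF True] right_mono[of a c] c(5) by (auto simp: ext_right_def)
          ultimately show ?thesis by simp
        next
          case False
          then have "D (Suc x') (Suc c) + D a c \<le> D (Suc x') c + D a (Suc c)"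
            using that by (intro monge) auto
          with False c(5) that show ?thesis by (simp add: ext_right_def)
        qed
        have "ext_left c (ext_right x' D) = ext_right x' D"
        proof (intro ext)
          fix a b
          show "ext_left c (ext_right x' D) a b = ext_right x' D a b"
            using up[of a] E.mono[of a a "Suc c" b] by (auto simp: ext_left_def)
        qed
        \<comment> \<open>\<open>D\<close> has no step at \<open>c\<close> from left end 0, so
          \<open>c\<close> does change \<open>D\<close>.\<close>
        moreover have "ext_left c D \<noteq> D"
        proof
          assume "ext_left c D = D"
          then have "ext_left c D 0 (Suc c) = D 0 (Suc c)" by simp
          then have "Suc (D 0 c) \<le> ?i" using flat[of 0] by (simp add: ext_left_def)
          moreover have "?i \<le> D 0 c"
            using c(4)[of c] c(5) mono[of 0 x' c c] c(1) zero[of "Suc c" "Suc x'"]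
            by (cases "x' = c") auto
          ultimately show False by simp
        qed
        ultimately have eq: "ext_left c D = ext_right x' D" using left[OF c(2)] x' by auto
        have "D 0 (Suc y) = j" using a1_eq[of "Suc y"] 0 2 lev by simp
        then have "ext_right x' D 0 (Suc y) = Suc j" using lev by (simp add: ext_right_eq)
        moreover have "ext_left c D 0 (Suc y) \<le> max j (Suc ?i)"
          using \<open>D 0 (Suc y) = j\<close> flat[of 0] right_mono[of 0 c] 2
          by (auto simp: ext_left_def)
        moreover have "?i < j" using mono[of "Suc x'" "Suc x'" "Suc c" y] 2 j by simp
        ultimately show False using eq by simp
      qed
    qed
  qed
  with c(6) have new: "bump x' D - steps D = {(c, ?i)}" by blast
  have "steps (ext_right x' D) = insert (c, ?i) (steps D)"
    using steps_ext_right[OF \<open>x' < n\<close>] new by blast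
  moreover have "(c, ?i) \<notin> steps D" using c(6) by simp
  ultimately have "card (steps (ext_right x' D)) = Suc (card (steps D))"
    using finite_steps by simp
  then show ?thesis using E.card_steps card_steps x' by simp
qed


section \<open>Insertion paths\<close>

lemma bump_exists:
  assumes "Suc i \<le> D (Suc x) (Suc y)"
  shows "\<exists>z\<le>y. (z, Suc i) \<in> bump x D"
proof -
  \<comment> \<open>Unit steps from the value 0 hit every level; \<open>z\<close> is where level
    \<open>Suc i\<close> is first reached.\<close>
  define z where "z = (LEAST z. Suc i \<le> D (Suc x) (Suc z))"
  have z: "Suc i \<le> D (Suc x) (Suc z)" unfolding z_def by (rule LeastI) fact
  have "z \<le> y" unfolding z_def by (rule Least_le) fact
  have "D (Suc x) z \<le> i"
  proof (cases z)
    case (Suc k)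
    then show ?thesis
      using not_less_Least[of k "\<lambda>z. Suc i \<le> D (Suc x) (Suc z)"] by (simp add: z_def)
  qed (simp add: zero)
  with z right_unit[of "Suc x" z] have "(z, Suc i) \<in> bump x D" by (auto simp: bump_def)
  with \<open>z \<le> y\<close> show ?thesis by blast
qed

text \<open>The rows visited by an insertion path form an initial segment, so a path that misses a
  row stops below it.\<close>

lemma bump_down:
  assumes "(y, j) \<in> bump x D" "i \<le> j"
  shows "\<exists>z. (z, i) \<in> bump x D"
proof (cases i)
  case 0
  then show ?thesis by (auto simp: bump_def)
next
  case (Suc k)
  then show ?thesis using bump_exists[of k x y] bump_level[OF assms(1)] assms(2) by blast
qed

lemma bump_less:
  assumes "(y, i) \<in> bump x D" "(z, j) \<in> bump x D" "i < j"
  shows "y < z"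
proof (rule ccontr)
  assume "\<not> y < z"
  then have "D (Suc x) (Suc z) \<le> D (Suc x) (Suc y)" by (intro mono) auto
  then show False using assms bump_level by fastforce
qed

lemma bump_unique:
  assumes "(y, i) \<in> bump x D" "(z, i) \<in> bump x D"
  shows "y = z"
proof -
  have "\<not> p < q" if "(p, i) \<in> bump x D" "(q, i) \<in> bump x D" for p q
  proof
    assume "p < q"
    then have "D (Suc x) (Suc p) \<le> D (Suc x) q" by (intro mono) auto
    moreover have "x < q" using \<open>p < q\<close> bump_level[OF that(1)] by simp
    ultimately show False using bump_level[OF that(1)] that(2) by (auto elim: bump_cases)
  qed
  then show ?thesis using assms by (metis linorder_neqE_nat)
qed

lemma bump_Suc_steps: "(y, Suc i) \<in> bump x D \<Longrightarrow> (y, i) \<in> steps D"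
  by (auto simp: bump_def steps_def)

text \<open>Together with \<open>bump_Suc_steps\<close>, this shows that the path continues with the
  smallest letter of row \<open>i\<close> beyond \<open>z\<close>, which is the bumping rule of
  \<open>N\<close>-insertion. For \<open>a \<le> x\<close> the Monge inequality moves the step at
  \<open>y\<close> to the left end \<open>Suc x\<close>.\<close>

lemma bump_next:
  assumes "(z, i) \<in> bump x D" "(y, i) \<in> steps D" "z < y"
  shows "\<exists>y'\<le>y. z < y' \<and> (y', Suc i) \<in> bump x D"
proof -
  from assms(2) obtain a where a: "D a (Suc y) = Suc i" "D a y = i" by (auto simp: steps_def)
  have z: "x \<le> z" "D (Suc x) (Suc z) = i" using bump_level[OF assms(1)] by auto
  have "Suc i \<le> D (Suc x) (Suc y)"
  proof (cases "a \<le> x")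
    case True
    then have "D a (Suc y) + D (Suc x) y \<le> D a y + D (Suc x) (Suc y)"
      using z assms(3) by (intro monge) auto
    moreover have "i \<le> D (Suc x) y" using mono[of "Suc x" "Suc x" "Suc z" y] z assms(3) by simp
    ultimately show ?thesis using a by simp
  next
    case False
    then show ?thesis using mono[of "Suc x" a "Suc y" "Suc y"] a by simp
  qed
  then obtain y' where "y' \<le> y" "(y', Suc i) \<in> bump x D" using bump_exists by blast
  with bump_less[OF assms(1)] show ?thesis by blast
qed

end

section \<open>Reversal\<close>

text \<open>
  The profile of the reversed word over the reversed alphabet. Truncated subtraction is harmless,
  since \<open>D a b\<close> is constant in \<open>b\<close> beyond \<open>n\<close> and zero for \<open>b \<le> a\<close>.
\<close>

definition opp :: "nat \<Rightarrow> (nat \<Rightarrow> nat \<Rightarrow> nat) \<Rightarrow> nat \<Rightarrow> nat \<Rightarrow> nat" where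
  "opp n D a b = D (n - b) (n - a)"

lemma opp_ext_left: "y < n \<Longrightarrow> opp n (ext_left y D) = ext_right (n - 1 - y) (opp n D)"
  by (intro ext) (auto simp: opp_def ext_left_def ext_right_def Suc_diff_Suc)

lemma opp_ext_right: "y < n \<Longrightarrow> opp n (ext_right y D) = ext_left (n - 1 - y) (opp n D)"
  by (intro ext) (auto simp: opp_def ext_left_def ext_right_def Suc_diff_Suc)

context profile
begin

lemma profile_opp: "profile n (opp n D)"
proof
  fix a b
  show "opp n D (Suc a) b \<le> opp n D a b" "opp n D a b \<le> opp n D a (Suc b)"
    by (auto simp: opp_def intro: mono)
  show "opp n D a b \<le> Suc (opp n D (Suc a) b)"
    using right_unit[of "n - b" "n - Suc a"] by (cases "a < n") (auto simp: opp_def Suc_diff_Suc)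
  show "opp n D a (Suc b) \<le> Suc (opp n D a b)"
    using left_unit[of "n - Suc b" "n - a"] by (cases "b < n") (auto simp: opp_def Suc_diff_Suc)
next
  fix a a' b b' assume "a \<le> a'" "a' \<le> b" "b \<le> (b'::nat)"
  then have "n - b' \<le> n - b" "n - b \<le> n - a'" "n - a' \<le> n - a" by auto
  then show "opp n D a b' + opp n D a' b \<le> opp n D a b + opp n D a' b'"
    unfolding opp_def using monge by (metis add.commute)
next
  fix a b
  show "b \<le> a \<Longrightarrow> opp n D a b = 0" by (simp add: opp_def zero)
  show "n \<le> b \<Longrightarrow> opp n D a b = opp n D a n" by (simp add: opp_def)
qed

lemma opp_opp: "opp n (opp n D) = D"
proof (intro ext)
  fix a b
  have "D (n - (n - a)) (n - (n - b)) = D a (n - (n - b))"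
    by (cases "a \<le> n") (auto simp: zero)
  also have "\<dots> = D a b"
  proof (cases "b \<le> n")
    case False
    then show ?thesis using stable[of b a] by simp
  qed simp
  finally show "opp n (opp n D) a b = D a b" by (simp add: opp_def)
qed

lemma opp_eq_iff:
  assumes "profile n E"
  shows "opp n D = opp n E \<longleftrightarrow> D = E"
  using opp_opp profile.opp_opp[OF assms] by metis

lemma profile_ext_left:
  assumes "y < n"
  shows "profile n (ext_left y D)"
proof -
  have "ext_left y D = opp n (ext_right (n - 1 - y) (opp n D))"
    using opp_ext_right[of "n - 1 - y" n "opp n D"] assms by (simp add: opp_opp)
  moreover have "profile n (ext_right (n - 1 - y) (opp n D))"
    using assms by (intro profile.profile_ext_right[OF profile_opp]) simp
  ultimately show ?thesis by (simp add: profile.profile_opp)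
qed

text \<open>One inequality suffices: applied to \<open>opp n D\<close> it gives the converse,
  because \<open>opp n\<close> is an involution on profiles.\<close>

lemma card_corners_le_opp: "card (corners D) \<le> card (corners (opp n D))"
proof -
  interpret O: profile n "opp n D" by (rule profile_opp)
  \<comment> \<open>The interval \<open>[a, b + 1)\<close> has mirror image
    \<open>[n - 1 - b, n - a)\<close>, whose last letter is \<open>n - 1 - a\<close>.\<close>
  let ?f = "\<lambda>(a, b). (n - 1 - b, n - 1 - a)"
  have "inj_on ?f (corners D)"
    by (rule inj_on_subset[OF _ corners_subset]) (auto simp: inj_on_def)
  moreover have "?f ` corners D \<subseteq> corners (opp n D)"
  proof clarify
    fix a b assume ab: "(a, b) \<in> corners D"
    then have "a \<le> b" "b < n" using corners_subset by auto
    then have "n - Suc (n - 1 - b) = b" "n - (n - 1 - b) = Suc b"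
      "n - Suc (n - 1 - a) = a" "n - (n - 1 - a) = Suc a" by auto
    then show "(n - 1 - b, n - 1 - a) \<in> corners (opp n D)"
      using ab unfolding corners_def opp_def by auto
  qed
  ultimately show ?thesis using card_inj_on_le O.finite_corners by blast
qed

lemma card_corners_opp: "card (corners (opp n D)) = card (corners D)"
  using card_corners_le_opp profile.card_corners_le_opp[OF profile_opp]
  by (simp add: opp_opp order_antisym)

lemma card_corners_ext_left:
  assumes "x < n" "ext_left x D \<noteq> D"
  shows "card (corners D) < card (corners (ext_left x D))"
proof -
  interpret O: profile n "opp n D" by (rule profile_opp)
  interpret L: profile n "ext_left x D" using assms(1) by (rule profile_ext_left)
  have "ext_right (n - 1 - x) (opp n D) \<noteq> opp n D"
    using assms(2) L.opp_eq_iff[OF profile_axioms] opp_ext_left[OF assms(1)] by metis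
  then have "card (corners (opp n D)) < card (corners (opp n (ext_left x D)))"
    using O.card_corners_ext_right[of "n - 1 - x"] assms(1) by (simp only: opp_ext_left) simp
  then show "card (corners D) < card (corners (ext_left x D))"
    by (simp only: card_corners_opp L.card_corners_opp)
qed

text \<open>Mirror image of \<open>cover_right\<close>: left multiplication by \<open>x\<close> is
  right multiplication by \<open>n - 1 - x\<close> on \<open>opp n D\<close>, and the hypotheses
  carry over because \<open>opp n\<close> is injective on profiles.\<close>

lemma cover_left:
  assumes "x < n" and ne: "ext_left x D \<noteq> D"
    and left: "\<And>y z. \<lbrakk>y < n; z < n; ext_left z (ext_left y D) = ext_left x D\<rbrakk>
      \<Longrightarrow> ext_left y D = D \<or> ext_left y D = ext_left x D"
    and right: "\<And>y. \<lbrakk>y < n; ext_right y (ext_left x D) = ext_left x D\<rbrakk>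
      \<Longrightarrow> ext_right y D = D \<or> ext_right y D = ext_left x D"
  shows "card (corners (ext_left x D)) = Suc (card (corners D))"
proof -
  let ?x = "n - 1 - x"
  interpret O: profile n "opp n D" by (rule profile_opp)
  interpret L: profile n "ext_left x D" using assms(1) by (rule profile_ext_left)
  have x: "ext_right ?x (opp n D) = opp n (ext_left x D)" using assms(1) by (simp add: opp_ext_left)
  have R: "ext_right y (opp n E) = opp n (ext_left (n - 1 - y) E)" if "y < n" for y E
    using that by (simp add: opp_ext_left)
  have L: "ext_left y (opp n E) = opp n (ext_right (n - 1 - y) E)" if "y < n" for y E
    using that by (simp add: opp_ext_right)
  have inj: "opp n E = opp n F \<longleftrightarrow> E = F" if "profile n E" "profile n F" for E F
    using that profile.opp_eq_iff by blast
  have "card (corners (ext_right ?x (opp n D))) = Suc (card (corners (opp n D)))"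
  proof (rule O.cover_right)
    show "?x < n" using assms(1) by simp
    show "ext_right ?x (opp n D) \<noteq> opp n D"
      unfolding x using ne inj[OF L.profile_axioms profile_axioms] by simp
  next
    fix y z assume yz: "y < n" "z < n"
      and eq: "ext_right z (ext_right y (opp n D)) = ext_right ?x (opp n D)"
    have p: "profile n (ext_left (n - 1 - y) D)" using yz by (intro profile_ext_left) simp
    have p2: "profile n (ext_left (n - 1 - z) (ext_left (n - 1 - y) D))"
      by (rule profile.profile_ext_left[OF p]) (use yz in simp)
    have "ext_left (n - 1 - z) (ext_left (n - 1 - y) D) = ext_left x D"
      using eq unfolding x using inj[OF p2 L.profile_axioms] yz by (simp add: R)
    then have "ext_left (n - 1 - y) D = D \<or> ext_left (n - 1 - y) D = ext_left x D"
      using yz by (intro left[of _ "n - 1 - z"]) simp_all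
    then show "ext_right y (opp n D) = opp n D \<or> ext_right y (opp n D) = ext_right ?x (opp n D)"
      unfolding x using yz by (auto simp: R)
  next
    fix y assume y: "y < n"
      and eq: "ext_left y (ext_right ?x (opp n D)) = ext_right ?x (opp n D)"
    have p: "profile n (ext_right (n - 1 - y) (ext_left x D))"
      using y by (intro L.profile_ext_right) simp
    have "ext_right (n - 1 - y) (ext_left x D) = ext_left x D"
      using eq unfolding x using inj[OF p L.profile_axioms] y by (simp add: L)
    then have "ext_right (n - 1 - y) D = D \<or> ext_right (n - 1 - y) D = ext_left x D"
      using y by (intro right) simp_all
    then show "ext_left y (opp n D) = opp n D \<or> ext_left y (opp n D) = ext_right ?x (opp n D)"
      unfolding x using y by (auto simp: L)
  qed
  then show ?thesis unfolding x by (simp add: card_corners_opp L.card_corners_opp)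
qed

end

section \<open>Strict growth of the box count\<close>

lemma corners_append_right:
  assumes "set v \<subseteq> {..<n}" "set t \<subseteq> {..<n}"
  shows "decr (v @ t) = decr v \<or> card (corners (decr v)) < card (corners (decr (v @ t)))"
  using assms(2)
proof (induction t rule: rev_induct)
  case (snoc x t)
  then have "profile n (decr (v @ t))" using assms(1) by (intro profile_decr) auto
  from profile.card_corners_ext_right[OF this, of x] snoc
  show ?case by (fastforce simp: decr_snoc simp flip: append_assoc)
qed simp

lemma corners_append_left:
  assumes "set v \<subseteq> {..<n}" "set s \<subseteq> {..<n}"
  shows "decr (s @ v) = decr v \<or> card (corners (decr v)) < card (corners (decr (s @ v)))"
  using assms(2)
proof (induction s)
  case (Cons x s)
  then have "profile n (decr (s @ v))" using assms(1) by (intro profile_decr) auto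
  from profile.card_corners_ext_left[OF this, of x] Cons
  show ?case by (fastforce simp: decr_Cons)
qed simp

section \<open>The factor order on profiles\<close>

text \<open>The \<open>J\<close>-order read on words, with equality of profiles in place of equality
  of induced maps.\<close>

definition factor_le :: "nat \<Rightarrow> nat list \<Rightarrow> nat list \<Rightarrow> bool" where
  "factor_le n u v \<longleftrightarrow>
    (\<exists>s t. set s \<subseteq> {..<n} \<and> set t \<subseteq> {..<n} \<and> decr u = decr (s @ v @ t))"

lemma factor_leI:
  "\<lbrakk>set s \<subseteq> {..<n}; set t \<subseteq> {..<n}; decr u = decr (s @ v @ t)\<rbrakk> \<Longrightarrow> factor_le n u v"
  by (auto simp: factor_le_def)

lemma factor_le_trans:
  assumes "factor_le n u v" "factor_le n v w"
  shows "factor_le n u w"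
proof -
  obtain s t s' t' where st: "set s \<subseteq> {..<n}" "set t \<subseteq> {..<n}" "decr u = decr (s @ v @ t)"
    "set s' \<subseteq> {..<n}" "set t' \<subseteq> {..<n}" "decr v = decr (s' @ w @ t')"
    using assms by (auto simp: factor_le_def)
  then have "decr u = decr ((s @ s') @ w @ (t' @ t))"
    using decr_cong[of v "s' @ w @ t'" s t] by simp
  then show ?thesis using st by (intro factor_leI[of "s @ s'" _ "t' @ t"]) auto
qed

text \<open>Strict growth of the box count down the order is what makes the \<open>J\<close>-order
  antisymmetric.\<close>

lemma factor_le_corners:
  assumes "factor_le n u v" "set v \<subseteq> {..<n}" "decr u \<noteq> decr v"
  shows "card (corners (decr v)) < card (corners (decr u))"
proof -
  obtain s t where st: "set s \<subseteq> {..<n}" "set t \<subseteq> {..<n}" "decr u = decr (s @ v @ t)"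
    using assms(1) by (auto simp: factor_le_def)
  show ?thesis
    using corners_append_right[OF assms(2) st(2)] corners_append_left[of "v @ t" n s] assms st
    by fastforce
qed

text \<open>Letters of \<open>t\<close> that fix the profile of \<open>v\<close> are dropped by
  congruence until one changes it; this reduces covers to multiplication by a single letter.\<close>

lemma first_changing_right:
  "decr (v @ t) \<noteq> decr v \<Longrightarrow> \<exists>x t'. decr (v @ t) = decr (v @ x # t') \<and>
    decr (v @ [x]) \<noteq> decr v \<and> set (x # t') \<subseteq> set t"
proof (induction t)
  case (Cons x t)
  show ?case
  proof (cases "decr (v @ [x]) = decr v")
    case True
    then have "decr (v @ x # t) = decr (v @ t)"
      using decr_cong[OF True, of "[]" t] by simp
    with Cons show ?thesis by (metis set_subset_Cons subset_trans)
  next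
    case False
    then show ?thesis by blast
  qed
qed simp

lemma first_changing_left:
  "decr (s @ v) \<noteq> decr v \<Longrightarrow> \<exists>x s'. decr (s @ v) = decr (s' @ x # v) \<and>
    decr (x # v) \<noteq> decr v \<and> set (x # s') \<subseteq> set s"
proof (induction s rule: rev_induct)
  case (snoc x s)
  show ?case
  proof (cases "decr (x # v) = decr v")
    case True
    then have "decr ((s @ [x]) @ v) = decr (s @ v)"
      using decr_cong[OF True, of s "[]"] by simp
    with snoc obtain y s' where
      "decr ((s @ [x]) @ v) = decr (s' @ y # v)" "decr (y # v) \<noteq> decr v" "set (y # s') \<subseteq> set s"
      by auto
    then show ?thesis by (intro exI[of _ y] exI[of _ s']) auto
  next
    case False
    then show ?thesis by (intro exI[of _ x] exI[of _ s]) auto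
  qed
qed simp

text \<open>The first letter that changes the profile of \<open>v\<close> on the way to
  \<open>u\<close> gives an element strictly below \<open>v\<close> and still above
  \<open>u\<close>, hence \<open>u\<close> itself. So \<open>u\<close> is \<open>v\<close> times one
  letter, and \<open>between\<close> provides the hypotheses of \<open>cover_right\<close> or
  \<open>cover_left\<close>.\<close>

lemma factor_cover:
  assumes "factor_le n u v" and v: "set v \<subseteq> {..<n}" and ne: "decr u \<noteq> decr v"
    and between: "\<And>z. \<lbrakk>set z \<subseteq> {..<n}; factor_le n z v; factor_le n u z\<rbrakk>
      \<Longrightarrow> decr z = decr v \<or> decr z = decr u"
  shows "card (corners (decr u)) = Suc (card (corners (decr v)))"
proof -
  interpret profile n "decr v" using v by (rule profile_decr)
  obtain s t where st: "set s \<subseteq> {..<n}" "set t \<subseteq> {..<n}" "decr u = decr (s @ v @ t)"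
    using assms(1) by (auto simp: factor_le_def)
  show ?thesis
  proof (cases "decr (v @ t) = decr v")
    case False
    then obtain x t' where x: "decr (v @ t) = decr (v @ x # t')" "decr (v @ [x]) \<noteq> decr v"
      "set (x # t') \<subseteq> set t"
      using first_changing_right by blast
    have "x < n" "set t' \<subseteq> {..<n}" using x(3) st(2) by auto
    have "decr u = decr (s @ (v @ [x]) @ t')"
      using decr_cong[OF x(1), of s "[]"] st(3) by simp
    then have "factor_le n u (v @ [x])" using st(1) \<open>set t' \<subseteq> _\<close> by (intro factor_leI)
    moreover have "factor_le n (v @ [x]) v" using \<open>x < n\<close> by (intro factor_leI[of "[]" _ "[x]"]) auto
    ultimately have u: "decr u = ext_right x (decr v)"
      using between[of "v @ [x]"] x(2) v \<open>x < n\<close> by (auto simp: decr_snoc)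
    have "card (corners (ext_right x (decr v))) = Suc (card (corners (decr v)))"
    proof (rule cover_right)
      show "ext_right x (decr v) \<noteq> decr v" using u ne by simp
    next
      fix y z assume yz: "y < n" "z < n"
        "ext_right z (ext_right y (decr v)) = ext_right x (decr v)"
      have "factor_le n u (v @ [y])"
        using yz u by (intro factor_leI[of "[]" _ "[z]"]) (auto simp: decr_snoc simp del: append_assoc)
      moreover have "factor_le n (v @ [y]) v" using yz by (intro factor_leI[of "[]" _ "[y]"]) auto
      ultimately show "ext_right y (decr v) = decr v \<or> ext_right y (decr v) = ext_right x (decr v)"
        using between[of "v @ [y]"] v yz u by (auto simp: decr_snoc)
    next
      \<comment> \<open>If \<open>y\<close> is absorbed on the left of \<open>v x\<close>, then
        \<open>u\<close> has the profile of \<open>y v x\<close>, so \<open>y v\<close> lies between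
        \<open>u\<close> and \<open>v\<close>.\<close>
      fix y assume y: "y < n" "ext_left y (ext_right x (decr v)) = ext_right x (decr v)"
      have "factor_le n u (y # v)"
        using y u \<open>x < n\<close> by (intro factor_leI[of "[]" _ "[x]"]) (auto simp: decr_snoc decr_Cons)
      moreover have "factor_le n (y # v) v" using y by (intro factor_leI[of "[y]" _ "[]"]) auto
      ultimately show "ext_left y (decr v) = decr v \<or> ext_left y (decr v) = ext_right x (decr v)"
        using between[of "y # v"] v y u by (auto simp: decr_Cons)
    qed fact
    with u show ?thesis by simp
  next
    case True
    then have us: "decr u = decr (s @ v)" using decr_cong[OF True, of s "[]"] st(3) by simp
    with ne obtain x s' where x: "decr (s @ v) = decr (s' @ x # v)" "decr (x # v) \<noteq> decr v"
      "set (x # s') \<subseteq> set s"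
      using first_changing_left[of s v] by auto
    have "x < n" "set s' \<subseteq> {..<n}" using x(3) st(1) by auto
    have "factor_le n u (x # v)" using us x(1) \<open>set s' \<subseteq> _\<close> by (intro factor_leI[of s' _ "[]"]) auto
    moreover have "factor_le n (x # v) v" using \<open>x < n\<close> by (intro factor_leI[of "[x]" _ "[]"]) auto
    ultimately have u: "decr u = ext_left x (decr v)"
      using between[of "x # v"] x(2) v \<open>x < n\<close> by (auto simp: decr_Cons)
    have "card (corners (ext_left x (decr v))) = Suc (card (corners (decr v)))"
    proof (rule cover_left)
      show "ext_left x (decr v) \<noteq> decr v" using u ne by simp
    next
      fix y z assume yz: "y < n" "z < n"
        "ext_left z (ext_left y (decr v)) = ext_left x (decr v)"
      have "factor_le n u (y # v)"
        using yz u by (intro factor_leI[of "[z]" _ "[]"]) (auto simp: decr_Cons)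
      moreover have "factor_le n (y # v) v" using yz by (intro factor_leI[of "[y]" _ "[]"]) auto
      ultimately show "ext_left y (decr v) = decr v \<or> ext_left y (decr v) = ext_left x (decr v)"
        using between[of "y # v"] v yz u by (auto simp: decr_Cons)
    next
      fix y assume y: "y < n" "ext_right y (ext_left x (decr v)) = ext_left x (decr v)"
      have "factor_le n u (v @ [y])"
        using y u \<open>x < n\<close>
        by (intro factor_leI[of "[x]" _ "[]"]) (auto simp: decr_snoc decr_Cons ext_left_ext_right)
      moreover have "factor_le n (v @ [y]) v" using y by (intro factor_leI[of "[]" _ "[y]"]) auto
      ultimately show "ext_right y (decr v) = decr v \<or> ext_right y (decr v) = ext_left x (decr v)"
        using between[of "v @ [y]"] v y u by (auto simp: decr_snoc)
    qed fact
    with u show ?thesis by simp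
  qed
qed

section \<open>Columns and \<open>N\<close>-tableaux\<close>

definition index :: "'a::linorder set \<Rightarrow> 'a \<Rightarrow> nat" where
  "index A x = card {y \<in> A. y < x}"

definition count_below :: "'a::linorder set \<Rightarrow> 'a set \<Rightarrow> nat \<Rightarrow> nat" where
  "count_below A \<gamma> b = card {y \<in> \<gamma>. index A y < b}"

text \<open>Empty above the top row, so that it can be compared with the level sets for every
  \<open>j\<close>.\<close>

definition row :: "'a set list \<Rightarrow> nat \<Rightarrow> 'a set" where
  "row T j = (if j < length T then T ! j else {})"

lemma row_Nil: "row [] j = {}"
  by (simp add: row_def)

lemma row_Cons: "row (B # T) j = (case j of 0 \<Rightarrow> B | Suc k \<Rightarrow> row T k)"
  by (simp add: row_def split: nat.split)

lemma num_boxes_row: "num_boxes T = (\<Sum>j<length T. card (row T j))"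
  unfolding num_boxes_def sum_list_sum_nth
  by (simp add: row_def atLeast0LessThan)

locale alphabet =
  fixes A :: "'a::linorder set"
  assumes finite_A: "finite A"
begin

abbreviation "idx \<equiv> index A"

abbreviation "word_profile w \<equiv> decr (map idx w)"

lemma index_less: "x \<in> A \<Longrightarrow> x < y \<Longrightarrow> idx x < idx y"
  unfolding index_def using finite_A by (intro psubset_card_mono) auto

lemma index_less_iff: "x \<in> A \<Longrightarrow> y \<in> A \<Longrightarrow> idx x < idx y \<longleftrightarrow> x < y"
  using index_less by (metis linorder_neqE order_less_asym)

lemma index_eq_iff: "x \<in> A \<Longrightarrow> y \<in> A \<Longrightarrow> idx x = idx y \<longleftrightarrow> x = y"
  using index_less by (metis linorder_neqE order_less_irrefl)

lemma index_le_iff: "x \<in> A \<Longrightarrow> y \<in> A \<Longrightarrow> idx x \<le> idx y \<longleftrightarrow> x \<le> y"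
  using index_less_iff by (metis linorder_not_less)

lemma inj_index: "inj_on idx A"
  using index_eq_iff by (auto simp: inj_on_def)

lemma index_lt_card: "x \<in> A \<Longrightarrow> idx x < card A"
  unfolding index_def using finite_A by (intro psubset_card_mono) auto

lemma index_image: "idx ` A = {..<card A}"
  using index_lt_card card_image[OF inj_index] by (intro card_subset_eq) auto

lemma word_letters: "w \<in> lists A \<Longrightarrow> set (map idx w) \<subseteq> {..<card A}"
  using index_lt_card by auto

lemma word_of_letters:
  assumes "set s \<subseteq> {..<card A}"
  obtains w where "w \<in> lists A" "map idx w = s"
proof -
  have "s \<in> map idx ` lists A" using assms index_image by (metis in_lists_conv_set lists_image subset_iff)
  then show thesis using that by auto
qed

lemma profile_word: "w \<in> lists A \<Longrightarrow> profile (card A) (word_profile w)"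
  using word_letters by (rule profile_decr)

section \<open>Columns as counting functions\<close>

lemma count_below_mono: "\<gamma> \<subseteq> A \<Longrightarrow> b \<le> c \<Longrightarrow> count_below A \<gamma> b \<le> count_below A \<gamma> c"
  unfolding count_below_def using finite_A by (intro card_mono) (auto intro: finite_subset)

lemma count_below_Suc:
  assumes "x \<in> A" "\<gamma> \<subseteq> A"
  shows "count_below A \<gamma> (Suc (idx x)) =
    (if x \<in> \<gamma> then Suc (count_below A \<gamma> (idx x)) else count_below A \<gamma> (idx x))"
proof -
  have fin: "finite {y \<in> \<gamma>. idx y < idx x}" using assms(2) finite_A by (auto intro: finite_subset)
  have "{y \<in> \<gamma>. idx y < Suc (idx x)} =
      (if x \<in> \<gamma> then insert x {y \<in> \<gamma>. idx y < idx x} else {y \<in> \<gamma>. idx y < idx x})"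
    using assms index_eq_iff by (auto simp: less_Suc_eq)
  then show ?thesis using fin by (simp add: count_below_def)
qed

lemma count_below_inject:
  assumes "\<gamma> \<subseteq> A" "\<delta> \<subseteq> A" "count_below A \<gamma> = count_below A \<delta>"
  shows "\<gamma> = \<delta>"
proof -
  have "x \<in> \<gamma> \<longleftrightarrow> x \<in> \<delta>" if "x \<in> A" for x
    using count_below_Suc[OF that assms(1)] count_below_Suc[OF that assms(2)] assms(3)
    by (auto split: if_splits)
  then show ?thesis using assms by blast
qed

lemma letter_act_subset: "x \<in> A \<Longrightarrow> \<gamma> \<subseteq> A \<Longrightarrow> letter_act x \<gamma> \<subseteq> A"
  by (auto simp: letter_act_def)

lemma word_act_subset: "w \<in> lists A \<Longrightarrow> \<gamma> \<subseteq> A \<Longrightarrow> word_act w \<gamma> \<subseteq> A"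
  by (induction w) (auto simp: word_act_def letter_act_subset)

text \<open>Exchanging \<open>m\<close> for \<open>x\<close> raises the count exactly when
  \<open>idx x < b \<le> idx m\<close>; there no letter of the column lies between, so the old count
  is the one at \<open>idx x\<close>. For larger \<open>b\<close> the letter \<open>m\<close> makes
  the old count win the maximum.\<close>

lemma count_below_letter_act:
  assumes x: "x \<in> A" and \<gamma>: "\<gamma> \<subseteq> A"
  shows "count_below A (letter_act x \<gamma>) b =
    (if idx x < b then max (count_below A \<gamma> b) (Suc (count_below A \<gamma> (idx x)))
     else count_below A \<gamma> b)"
proof -
  let ?S = "\<lambda>b. {y \<in> \<gamma>. idx y < b}"
  have fin: "finite (?S b)" for b using \<gamma> finite_A by (auto intro: finite_subset)
  have mono: "count_below A \<gamma> (idx x) \<le> count_below A \<gamma> b" if "idx x < b"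
    using count_below_mono[OF \<gamma>] that by simp
  show ?thesis
  proof (cases "\<forall>y\<in>\<gamma>. y < x")
    case True
    then have "\<forall>y\<in>\<gamma>. idx y < idx x" using index_less \<gamma> by blast
    then have "?S b = \<gamma>" "?S (idx x) = \<gamma>" if "idx x < b" using that by auto
    moreover have "{y \<in> insert x \<gamma>. idx y < b} = (if idx x < b then insert x (?S b) else ?S b)" by auto
    moreover have "x \<notin> \<gamma>" "letter_act x \<gamma> = insert x \<gamma>" using True by (auto simp: letter_act_def)
    ultimately show ?thesis using fin[of b] by (auto simp: count_below_def)
  next
    case False
    define m where "m = Min {y \<in> \<gamma>. x \<le> y}"
    have fin': "finite {y \<in> \<gamma>. x \<le> y}" using \<gamma> finite_A by (auto intro: finite_subset)
    have "m \<in> {y \<in> \<gamma>. x \<le> y}" unfolding m_def using fin' False by (intro Min_in) (auto simp: not_less)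
    then have m: "m \<in> \<gamma>" "x \<le> m" "m \<in> A" using \<gamma> by auto
    have least: "m \<le> y" if "y \<in> \<gamma>" "x \<le> y" for y
      unfolding m_def using fin' that by (intro Min_le) auto
    have act: "letter_act x \<gamma> = insert x (\<gamma> - {m})"
      using False unfolding letter_act_def m_def by auto
    have ixm: "idx x \<le> idx m" using m x index_le_iff by simp
    have x_in: "x \<in> \<gamma> \<longleftrightarrow> x = m" using least[of x] m by auto
    consider "b \<le> idx x" | "idx x < b" "idx m < b" | "idx x < b" "b \<le> idx m" by linarith
    then show ?thesis
    proof cases
      case 1
      then have "{y \<in> insert x (\<gamma> - {m}). idx y < b} = ?S b" using ixm by auto
      with 1 show ?thesis by (simp add: count_below_def act)
    next
      case 2
      then have S: "{y \<in> insert x (\<gamma> - {m}). idx y < b} = insert x (?S b - {m})" by auto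
      have "m \<in> ?S b" using 2 m by simp
      have "card (insert x (?S b - {m})) = Suc (card (?S b - {m}))"
        using x_in fin[of b] by (intro card_insert_disjoint) auto
      also have "\<dots> = card (?S b)" using fin \<open>m \<in> ?S b\<close> by (rule card_Suc_Diff1)
      finally have "card (insert x (?S b - {m})) = card (?S b)" .
      moreover have "card (insert m (?S (idx x))) \<le> card (?S b)"
        using 2 m fin[of b] by (intro card_mono) auto
      then have "Suc (card (?S (idx x))) \<le> card (?S b)" using fin[of "idx x"] ixm by simp
      ultimately show ?thesis using 2 unfolding count_below_def act S by simp
    next
      case 3
      have "?S b = ?S (idx x)"
      proof (intro equalityI subsetI)
        fix y assume y: "y \<in> ?S b"
        then have "y \<in> A" using \<gamma> by auto
        have "\<not> x \<le> y"
        proof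
          assume "x \<le> y"
          then have "idx m \<le> idx y" using least[of y] y m \<open>y \<in> A\<close> index_le_iff by auto
          with y 3 show False by simp
        qed
        then show "y \<in> ?S (idx x)" using y \<open>y \<in> A\<close> x index_less_iff by auto
      qed (use 3 in auto)
      moreover have "{y \<in> insert x (\<gamma> - {m}). idx y < b} = insert x (?S b)" using 3 by auto
      moreover have "x \<notin> ?S b" using x_in 3 by auto
      ultimately show ?thesis using 3 fin[of b] by (simp add: count_below_def act)
    qed
  qed
qed

text \<open>The new count is the maximum over \<open>c \<le> b\<close> of
  \<open>word_profile w c b + count_below A \<gamma> c\<close>: letters below \<open>c\<close> come
  from the column, those from \<open>c\<close> on from the word. Thresholds \<open>k\<close> avoid
  maxima of sets.\<close>

lemma count_below_word_act:
  assumes "w \<in> lists A" "\<gamma> \<subseteq> A"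
  shows "k \<le> count_below A (word_act w \<gamma>) b \<longleftrightarrow>
    (\<exists>c\<le>b. k \<le> word_profile w c b + count_below A \<gamma> c)"
  using assms(1)
proof (induction w arbitrary: k b)
  case Nil
  show ?case
    using count_below_mono[OF assms(2)] by (auto simp: word_act_def decr_Nil intro: order_trans)
next
  case (Cons x w)
  then have x: "x \<in> A" and w: "w \<in> lists A" by auto
  let ?D = "word_profile w" and ?g = "count_below A \<gamma>"
  have "count_below A (word_act (x # w) \<gamma>) b =
      (if idx x < b then max (count_below A (word_act w \<gamma>) b)
        (Suc (count_below A (word_act w \<gamma>) (idx x))) else count_below A (word_act w \<gamma>) b)"
    using count_below_letter_act[OF x word_act_subset[OF w assms(2)]] by (simp add: word_act_def)
  then have "k \<le> count_below A (word_act (x # w) \<gamma>) b \<longleftrightarrow>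
      k \<le> count_below A (word_act w \<gamma>) b \<or>
      idx x < b \<and> k - 1 \<le> count_below A (word_act w \<gamma>) (idx x)"
    by auto
  also have "\<dots> \<longleftrightarrow> (\<exists>c\<le>b. k \<le> ?D c b + ?g c) \<or>
      idx x < b \<and> (\<exists>c\<le>idx x. k - 1 \<le> ?D c (idx x) + ?g c)"
    using Cons.IH by simp
  also have "\<dots> \<longleftrightarrow> (\<exists>c\<le>b. k \<le> ?D c b + ?g c) \<or>
      idx x < b \<and> (\<exists>c\<le>idx x. k \<le> Suc (?D c (idx x)) + ?g c)"
    by (simp add: le_diff_conv)
  also have "\<dots> \<longleftrightarrow> (\<exists>c\<le>b. k \<le> ?D c b + ?g c \<or>
      c \<le> idx x \<and> idx x < b \<and> k \<le> Suc (?D c (idx x)) + ?g c)"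
    by (meson le_trans less_imp_le_nat)
  also have "\<dots> \<longleftrightarrow> (\<exists>c\<le>b. k \<le> word_profile (x # w) c b + ?g c)"
    by (intro ex_cong1 conj_cong refl) (auto simp: decr_Cons ext_left_def max_def)
  finally show ?case .
qed

lemma count_below_initial:
  assumes "c \<le> card A"
  shows "count_below A {y \<in> A. idx y < c} d = min c d"
proof -
  have "idx ` {y \<in> A. idx y < min c d} = {..<min c d}"
  proof (intro equalityI subsetI)
    fix i assume i: "i \<in> {..<min c d}"
    then have "i \<in> idx ` A" using index_image assms by simp
    then show "i \<in> idx ` {y \<in> A. idx y < min c d}" using i by auto
  qed auto
  moreover have "card (idx ` {y \<in> A. idx y < min c d}) = card {y \<in> A. idx y < min c d}"
    by (intro card_image inj_on_subset[OF inj_index]) auto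
  ultimately have "card {y \<in> A. idx y < min c d} = min c d" by (metis card_lessThan)
  moreover have "{y \<in> {y \<in> A. idx y < c}. idx y < d} = {y \<in> A. idx y < min c d}" by auto
  ultimately show ?thesis by (simp add: count_below_def)
qed

text \<open>For an initial column the maximum is attained at its length \<open>c\<close>: a smaller
  left end gains at most one per letter, which the column loses, and a larger one only lowers the
  profile.\<close>

lemma count_below_word_act_initial:
  assumes w: "w \<in> lists A" and c: "c \<le> card A" "c \<le> b"
  shows "count_below A (word_act w {y \<in> A. idx y < c}) b = word_profile w c b + c"
proof -
  interpret profile "card A" "word_profile w" using w by (rule profile_word)
  have "k \<le> count_below A (word_act w {y \<in> A. idx y < c}) b \<longleftrightarrow> k \<le> word_profile w c b + c" for k
  proof -
    have "word_profile w d b + min c d \<le> word_profile w c b + c" for d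
      using le_right_plus_diff[of d c b] mono[of c d b b] by (cases "d \<le> c") auto
    then show ?thesis
      using c by (subst count_below_word_act[OF w])
        (auto simp: count_below_initial intro: order_trans exI[of _ c])
  qed
  then show ?thesis by (metis order_antisym order_refl)
qed

text \<open>Initial columns recover the profile from the action, and the max-plus formula recovers
  the action from the profile.\<close>

lemma styl_map_eq_iff:
  assumes u: "u \<in> lists A" and v: "v \<in> lists A"
  shows "styl_map A u = styl_map A v \<longleftrightarrow> word_profile u = word_profile v"
proof
  assume eq: "styl_map A u = styl_map A v"
  interpret U: profile "card A" "word_profile u" using u by (rule profile_word)
  interpret V: profile "card A" "word_profile v" using v by (rule profile_word)
  show "word_profile u = word_profile v"
  proof (intro ext)
    fix c b
    show "word_profile u c b = word_profile v c b"
    proof (cases "c \<le> card A \<and> c \<le> b")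
      case True
      have "word_act u {y \<in> A. idx y < c} = word_act v {y \<in> A. idx y < c}"
        using fun_cong[OF eq, of "{y \<in> A. idx y < c}"] by (simp add: styl_map_def)
      then show ?thesis
        using True count_below_word_act_initial[OF u, of c b]
          count_below_word_act_initial[OF v, of c b] by simp
    next
      \<comment> \<open>Outside this range both profiles vanish.\<close>
      case False
      then show ?thesis
        using U.stable[of b c] V.stable[of b c] U.zero[of b c] V.zero[of b c]
          U.zero[of "card A" c] V.zero[of "card A" c] by (cases "b \<le> c") auto
    qed
  qed
next
  assume eq: "word_profile u = word_profile v"
  have "word_act u \<gamma> = word_act v \<gamma>" if "\<gamma> \<subseteq> A" for \<gamma>
  proof (rule count_below_inject)
    show "count_below A (word_act u \<gamma>) = count_below A (word_act v \<gamma>)"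
    proof
      fix b
      have "k \<le> count_below A (word_act u \<gamma>) b \<longleftrightarrow> k \<le> count_below A (word_act v \<gamma>) b" for k
        using count_below_word_act[OF u that] count_below_word_act[OF v that] eq by simp
      then show "count_below A (word_act u \<gamma>) b = count_below A (word_act v \<gamma>) b"
        by (metis order_antisym order_refl)
    qed
  qed (use word_act_subset u v that in auto)
  then show "styl_map A u = styl_map A v" by (simp add: styl_map_def restrict_def fun_eq_iff)
qed

section \<open>\<open>N\<close>-insertion in terms of profiles\<close>

text \<open>Induction on the rows, with \<open>T\<close> holding row \<open>i\<close> and those
  above it, and \<open>z\<close> the entry of the insertion path in row \<open>i\<close>. The letter
  bumped out of row \<open>i\<close> is the entry of the path in row \<open>i + 1\<close>.\<close>

lemma row_N_insert:
  assumes "profile (card A) D" "z \<in> A" "(idx z, i) \<in> bump x D"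
    and "\<And>j. row T j = {y \<in> A. (idx y, i + j) \<in> steps D}"
  shows "row (N_insert z T) j = {y \<in> A. (idx y, i + j) \<in> steps D \<union> bump x D}"
  using assms(2-)
proof (induction T arbitrary: z i j)
  case Nil
  interpret profile "card A" D by fact
  have none: "(idx y, i + k) \<notin> steps D" if "y \<in> A" for y k
    using Nil.prems(3)[of k] that by (auto simp: row_Nil)
  \<comment> \<open>A next entry of the path would have to be a letter of row \<open>i\<close>,
    which is empty.\<close>
  have "\<nexists>y. (y, Suc i) \<in> bump x D"
  proof
    assume "\<exists>y. (y, Suc i) \<in> bump x D"
    then obtain y where "(y, i) \<in> steps D" using bump_Suc_steps by blast
    moreover from this obtain y' where "y' \<in> A" "y = idx y'" using steps_fst index_image by blast
    ultimately show False using none[of y' 0] by simp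
  qed
  then have above: "(y, i + Suc k) \<notin> bump x D" for y k
    using bump_down[of y "i + Suc k" x "Suc i"] by auto
  have uniq: "y = z" if "y \<in> A" "(idx y, i) \<in> bump x D" for y
    using bump_unique[OF that(2) Nil.prems(2)] index_eq_iff that(1) Nil.prems(1) by simp
  show ?case
  proof (cases j)
    case 0
    have "{y \<in> A. (idx y, i) \<in> steps D \<union> bump x D} = {z}"
      using none[of _ 0] uniq Nil.prems(1,2) unfolding add_0_right by blast
    with 0 show ?thesis by (simp add: row_Cons)
  next
    case (Suc k)
    have "{y \<in> A. (idx y, i + Suc k) \<in> steps D \<union> bump x D} = {}"
      using none above by blast
    with Suc show ?thesis by (simp add: row_Cons row_Nil)
  qed
next
  case (Cons B T)
  interpret profile "card A" D by fact
  have B: "B = {y \<in> A. (idx y, i) \<in> steps D}" using Cons.prems(3)[of 0] by (simp add: row_Cons)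
  have T: "row T k = {y \<in> A. (idx y, Suc i + k) \<in> steps D}" for k
    using Cons.prems(3)[of "Suc k"] by (simp add: row_Cons)
  have lift: "\<exists>y'\<in>B. y = idx y' \<and> z < y'" if "(y, Suc i) \<in> bump x D" for y
  proof -
    have "(y, i) \<in> steps D" using that by (rule bump_Suc_steps)
    moreover from this obtain y' where "y' \<in> A" "y = idx y'" using steps_fst index_image by blast
    moreover have "idx z < y" using bump_less[OF Cons.prems(2) that] by simp
    ultimately show ?thesis using B index_less_iff Cons.prems(1) by auto
  qed
  have first: "insert z B = {y \<in> A. (idx y, i) \<in> steps D \<union> bump x D}"
    using B bump_unique[OF _ Cons.prems(2)] index_eq_iff Cons.prems(1,2) by auto
  show ?case
  proof (cases j)
    case 0
    then show ?thesis using first by (simp add: row_Cons)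
  next
    case (Suc k)
    show ?thesis
    proof (cases "\<exists>y\<in>B. z < y")
      case True
      define m where "m = Min {y \<in> B. z < y}"
      have fin: "finite {y \<in> B. z < y}" using B finite_A by simp
      have "m \<in> {y \<in> B. z < y}" unfolding m_def using fin True by (intro Min_in) auto
      then have m: "m \<in> A" "(idx m, i) \<in> steps D" "z < m" using B by auto
      then obtain y where y: "y \<le> idx m" "(y, Suc i) \<in> bump x D"
        using bump_next[OF Cons.prems(2), of "idx m"] index_less Cons.prems(1) by blast
      from lift[OF y(2)] obtain y' where y': "y' \<in> B" "y = idx y'" "z < y'" by blast
      then have "m \<le> y'" unfolding m_def using fin by (intro Min_le) auto
      \<comment> \<open>\<open>bump_next\<close> bounds the next entry of the path by
        \<open>m\<close>, and minimality of \<open>m\<close> gives the converse.\<close>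
      then have "idx m = y" using y y' m B index_le_iff by (metis (lifting) mem_Collect_eq order_antisym)
      then have "row (N_insert m T) k = {y \<in> A. (idx y, Suc i + k) \<in> steps D \<union> bump x D}"
        using Cons.IH[OF m(1) _ T] y(2) by simp
      with True Suc show ?thesis by (simp add: row_Cons m_def)
    next
      case False
      then have "\<nexists>y. (y, Suc i) \<in> bump x D" using lift by blast
      then have "(y, Suc i + k) \<notin> bump x D" for y using bump_down[of y "Suc i + k" x "Suc i"] by auto
      with False Suc T[of k] show ?thesis by (simp add: row_Cons)
    qed
  qed
qed

lemma row_N_tableau:
  assumes "w \<in> lists A"
  shows "row (N_tableau w) j = {y \<in> A. (idx y, j) \<in> steps (word_profile w)}"
  using assms
proof (induction w arbitrary: j rule: rev_induct)
  case Nil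
  show ?case by (simp add: N_tableau_def row_Nil decr_Nil steps_def)
next
  case (snoc x w)
  then have x: "x \<in> A" and w: "w \<in> lists A" by auto
  interpret profile "card A" "word_profile w" using w by (rule profile_word)
  have "row (N_insert x (N_tableau w)) j =
      {y \<in> A. (idx y, 0 + j) \<in> steps (word_profile w) \<union> bump (idx x) (word_profile w)}"
    using profile_axioms x snoc.IH[OF w] by (intro row_N_insert) (auto simp: bump_def)
  then show ?case
    using steps_ext_right[OF index_lt_card[OF x]] by (simp add: N_tableau_def decr_snoc)
qed

lemma num_boxes_N_tableau:
  assumes w: "w \<in> lists A"
  shows "num_boxes (N_tableau w) = card (corners (word_profile w))"
proof -
  interpret profile "card A" "word_profile w" using w by (rule profile_word)
  let ?T = "N_tableau w"
  let ?S = "SIGMA j:{..<length ?T}. row ?T j"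
  have "bij_betw (\<lambda>(j, y). (idx y, j)) ?S (steps (word_profile w))"
  proof (rule bij_betw_imageI)
    show "inj_on (\<lambda>(j, y). (idx y, j)) ?S"
      using index_eq_iff by (auto simp: inj_on_def row_N_tableau[OF w])
    show "(\<lambda>(j, y). (idx y, j)) ` ?S = steps (word_profile w)"
    proof (intro equalityI subsetI)
      fix p assume "p \<in> steps (word_profile w)"
      then obtain i j where p: "p = (i, j)" "(i, j) \<in> steps (word_profile w)" by (cases p) auto
      then obtain y where y: "y \<in> A" "i = idx y" using steps_fst index_image by blast
      then have "y \<in> row ?T j" using p row_N_tableau[OF w] by simp
      moreover from this have "j < length ?T" by (auto simp: row_def split: if_splits)
      ultimately show "p \<in> (\<lambda>(j, y). (idx y, j)) ` ?S" using p y by force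
    qed (auto simp: row_N_tableau[OF w])
  qed
  then have "card ?S = card (corners (word_profile w))"
    using bij_betw_same_card card_steps by metis
  moreover have "finite (row ?T j)" for j using finite_A by (simp add: row_N_tableau[OF w])
  ultimately show ?thesis by (simp add: num_boxes_row card_SigmaI)
qed

section \<open>The \<open>J\<close>-order on words\<close>

lemma styl_map_append:
  assumes "v \<in> lists A"
  shows "styl_map A (u @ v) = compose (Pow A) (styl_map A u) (styl_map A v)"
proof
  fix \<gamma>
  show "styl_map A (u @ v) \<gamma> = compose (Pow A) (styl_map A u) (styl_map A v) \<gamma>"
    using word_act_subset[OF assms, of \<gamma>]
    by (simp add: styl_map_def compose_def word_act_def)
qed

lemma J_order_styl_map:
  assumes u: "u \<in> lists A" and v: "v \<in> lists A"
  shows "(styl_map A u, styl_map A v) \<in> J_order (Styl A) \<longleftrightarrow>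
    factor_le (card A) (map idx u) (map idx v)"
proof -
  have "(styl_map A u, styl_map A v) \<in> J_order (Styl A) \<longleftrightarrow>
      (\<exists>s\<in>lists A. \<exists>t\<in>lists A. styl_map A u =
        compose (Pow A) (compose (Pow A) (styl_map A s) (styl_map A v)) (styl_map A t))"
    using u v by (auto simp: J_order_def Styl_def)
  also have "\<dots> \<longleftrightarrow> (\<exists>s\<in>lists A. \<exists>t\<in>lists A. styl_map A u = styl_map A (s @ v @ t))"
    using v by (intro bex_cong refl) (simp add: styl_map_append flip: append_assoc)
  also have "\<dots> \<longleftrightarrow> (\<exists>s\<in>lists A. \<exists>t\<in>lists A. word_profile u = word_profile (s @ v @ t))"
    using u v by (intro bex_cong refl) (simp add: styl_map_eq_iff)
  also have "\<dots> \<longleftrightarrow> factor_le (card A) (map idx u) (map idx v)"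
  proof
    assume "\<exists>s\<in>lists A. \<exists>t\<in>lists A. word_profile u = word_profile (s @ v @ t)"
    then obtain s t where "s \<in> lists A" "t \<in> lists A" "word_profile u = word_profile (s @ v @ t)"
      by blast
    then show "factor_le (card A) (map idx u) (map idx v)"
      using word_letters by (intro factor_leI[of "map idx s" _ "map idx t"]) auto
  next
    assume "factor_le (card A) (map idx u) (map idx v)"
    then obtain s t where st: "set s \<subseteq> {..<card A}" "set t \<subseteq> {..<card A}"
      "word_profile u = decr (s @ map idx v @ t)"
      by (auto simp: factor_le_def)
    obtain s' t' where "s' \<in> lists A" "map idx s' = s" "t' \<in> lists A" "map idx t' = t"
      using word_of_letters st(1,2) by metis
    then show "\<exists>s\<in>lists A. \<exists>t\<in>lists A. word_profile u = word_profile (s @ v @ t)"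
      using st(3) by (intro bexI[of _ s'] bexI[of _ t']) auto
  qed
  finally show ?thesis .
qed

lemma styl_map_less_boxes:
  assumes u: "u \<in> lists A" and v: "v \<in> lists A"
    and "(styl_map A u, styl_map A v) \<in> J_order (Styl A)" "styl_map A u \<noteq> styl_map A v"
  shows "num_boxes (N_tableau v) < num_boxes (N_tableau u)"
  using factor_le_corners[of "card A" "map idx u" "map idx v"] assms word_letters[OF v]
  by (simp add: J_order_styl_map styl_map_eq_iff num_boxes_N_tableau)

lemma styl_map_cover_boxes:
  assumes u: "u \<in> lists A" and v: "v \<in> lists A"
    and cov: "covers (carrier (Styl A)) (J_order (Styl A)) (styl_map A v) (styl_map A u)"
  shows "num_boxes (N_tableau u) = Suc (num_boxes (N_tableau v))"
proof -
  have le: "factor_le (card A) (map idx u) (map idx v)" and ne: "word_profile u \<noteq> word_profile v"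
    using cov u v by (auto simp: covers_def below_def J_order_styl_map styl_map_eq_iff)
  have "card (corners (word_profile u)) = Suc (card (corners (word_profile v)))"
  proof (rule factor_cover[OF le word_letters[OF v] ne])
    fix z assume z: "set z \<subseteq> {..<card A}" "factor_le (card A) z (map idx v)"
      "factor_le (card A) (map idx u) z"
    obtain w where w: "w \<in> lists A" "map idx w = z" using word_of_letters[OF z(1)] by blast
    have "styl_map A w \<in> carrier (Styl A)" using w by (simp add: Styl_def)
    then have "\<not> (below (J_order (Styl A)) (styl_map A u) (styl_map A w) \<and>
        below (J_order (Styl A)) (styl_map A w) (styl_map A v))"
      using cov by (auto simp: covers_def)
    then show "decr z = word_profile v \<or> decr z = word_profile u"
      using w z u v by (auto simp: below_def J_order_styl_map styl_map_eq_iff)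
  qed
  then show ?thesis using u v by (simp add: num_boxes_N_tableau)
qed

end

section \<open>Graded posets\<close>

text \<open>\<open>h z - h x\<close> is a rank function. Every rank function satisfies
  \<open>rk e = rk x + h x\<close>, by climbing covers from \<open>x\<close> to \<open>e\<close>, so
  the co-rank does not depend on the one chosen by \<open>poset_rank\<close>.\<close>

lemma graded_by_height:
  fixes h :: "'p \<Rightarrow> nat"
  assumes fin: "finite P" and sub: "r \<subseteq> P \<times> P"
    and refl: "\<And>x. x \<in> P \<Longrightarrow> (x, x) \<in> r" and trans: "trans r"
    and less: "\<And>x y. (x, y) \<in> r \<Longrightarrow> x \<noteq> y \<Longrightarrow> h y < h x"
    and cover: "\<And>x y. x \<in> P \<Longrightarrow> y \<in> P \<Longrightarrow> covers P r y x \<Longrightarrow> h x = Suc (h y)"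
    and bot: "z \<in> P" "\<And>x. x \<in> P \<Longrightarrow> (z, x) \<in> r"
    and top: "e \<in> P" "\<And>x. x \<in> P \<Longrightarrow> (x, e) \<in> r" "h e = 0"
  shows "graded_poset P r" and "x \<in> P \<Longrightarrow> corank P r x = int (h x)"
proof -
  have anti: "x = y" if "(x, y) \<in> r" "(y, x) \<in> r" for x y
    using less[OF that(1)] less[OF that(2)] by (cases "x = y") auto
  have po: "partial_order_on P r"
    using sub refl trans anti
    by (auto simp: partial_order_on_def preorder_on_def refl_on_def antisym_def)
  have min: "poset_min P r = z" unfolding poset_min_def
    using bot anti by (intro the_equality) blast+
  have max: "poset_max P r = e" unfolding poset_max_def
    using top anti by (intro the_equality) blast+
  have le_z: "h x \<le> h z" if "x \<in> P" for x
    using less[OF bot(2)[OF that]] by (cases "x = z") auto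
  \<comment> \<open>Truncated subtraction is exact here because the minimum \<open>z\<close> has the
    largest height.\<close>
  have ex: "rank_function P r (\<lambda>x. h z - h x)"
    unfolding rank_function_def
  proof (intro conjI ballI impI)
    fix x y assume xy: "x \<in> P" "y \<in> P"
    show "h z - h x < h z - h y" if "below r x y"
      using less[of x y] that le_z[OF xy(1)] by (auto simp: below_def)
    show "h z - h y = h z - h x + 1" if "covers P r y x"
      using cover[OF xy that] le_z[OF xy(1)] by simp
  qed
  with po fin show "graded_poset P r" by (auto simp: graded_poset_def)
  have "rank_function P r (poset_rank P r)"
    using someI[of "\<lambda>rk. rank_function P r rk \<and> rk (poset_min P r) = 0", OF conjI[OF ex]]
    by (simp add: poset_rank_def min)
  moreover have "rk e = rk x + h x" if rk: "rank_function P r rk" and "x \<in> P" for rk x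
    using \<open>x \<in> P\<close>
  proof (induction "h x" arbitrary: x rule: less_induct)
    case (less x)
    show ?case
    proof (cases "x = e")
      case False
      define S where "S = {y \<in> P. below r x y}"
      have "e \<in> S" using False top less.prems by (auto simp: S_def below_def)
      moreover have "finite S" using fin by (simp add: S_def)
      ultimately have "Max (h ` S) \<in> h ` S" by (intro Max_in) auto
      \<comment> \<open>An element of largest height strictly above \<open>x\<close> covers
        \<open>x\<close>, since anything in between would have a larger height.\<close>
      then obtain y where y: "y \<in> S" "h y = Max (h ` S)" by force
      have "covers P r y x"
        unfolding covers_def
      proof (intro conjI notI)
        show "below r x y" using y by (simp add: S_def)
        assume "\<exists>w\<in>P. below r x w \<and> below r w y"
        then obtain w where w: "w \<in> S" "below r w y" by (auto simp: S_def)
        then have "h y < h w" using assms(5) by (simp add: below_def)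
        moreover have "h w \<le> Max (h ` S)" using w \<open>finite S\<close> by simp
        ultimately show False using y by simp
      qed
      moreover have "y \<in> P" using y by (simp add: S_def)
      ultimately have "rk y = rk x + 1" "h x = Suc (h y)"
        using rk cover less.prems by (auto simp: rank_function_def)
      with less.hyps[of y] \<open>y \<in> P\<close> show ?thesis by simp
    qed (simp add: top)
  qed
  ultimately have "poset_rank P r e = poset_rank P r x + h x" if "x \<in> P"
    using that by blast
  then show "x \<in> P \<Longrightarrow> corank P r x = int (h x)" by (simp add: corank_def max)
qed

section \<open>Gradedness of the stylic monoid\<close>

theorem theorem11p8:
  fixes A :: "'a::linorder set"
  assumes "finite A"
  shows "graded_poset (carrier (Styl A)) (J_order (Styl A)) \<and>
    (\<forall>w\<in>lists A.
      corank (carrier (Styl A)) (J_order (Styl A)) (styl_map A w)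
        = int (num_boxes (N_tableau w)))"
proof -
  interpret alphabet A using assms by unfold_locales
  let ?P = "carrier (Styl A)" and ?r = "J_order (Styl A)"
  have P: "?P = styl_map A ` lists A" by (simp add: Styl_def)
  \<comment> \<open>The box count depends only on the profile, so any word inducing \<open>m\<close>
    may be chosen.\<close>
  define h where "h m = num_boxes (N_tableau (SOME w. w \<in> lists A \<and> styl_map A w = m))" for m
  have h: "h (styl_map A w) = num_boxes (N_tableau w)" if "w \<in> lists A" for w
  proof -
    let ?u = "SOME u. u \<in> lists A \<and> styl_map A u = styl_map A w"
    have "?u \<in> lists A \<and> styl_map A ?u = styl_map A w" by (rule someI[of _ w]) (use that in simp)
    then have u: "?u \<in> lists A" "word_profile ?u = word_profile w"
      using that styl_map_eq_iff by blast+
    show ?thesis unfolding h_def num_boxes_N_tableau[OF u(1)] num_boxes_N_tableau[OF that] u(2) ..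
  qed
  \<comment> \<open>Restriction to \<open>Pow A\<close> makes the maps extensional, which bounds
    their number.\<close>
  have "?P \<subseteq> Pow A \<rightarrow>\<^sub>E Pow A"
    unfolding P styl_map_def using word_act_subset
    by (intro image_subsetI restrict_PiE_iff[THEN iffD2] ballI PowI) auto
  moreover have "finite (Pow A \<rightarrow>\<^sub>E Pow A)" using assms by (intro finite_PiE) auto
  ultimately have fin: "finite ?P" by (rule finite_subset)
  have less: "h y < h x" if xy: "(x, y) \<in> ?r" "x \<noteq> y" for x y
  proof -
    obtain u v where "u \<in> lists A" "x = styl_map A u" "v \<in> lists A" "y = styl_map A v"
      using xy(1) P by (auto simp: J_order_def)
    then show ?thesis using xy styl_map_less_boxes[of u v] by (simp add: h)
  qed
  have trans: "trans ?r"
  proof (rule transI)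
    fix x y z assume xyz: "(x, y) \<in> ?r" "(y, z) \<in> ?r"
    then obtain u v w where w: "u \<in> lists A" "v \<in> lists A" "w \<in> lists A"
      and eq: "x = styl_map A u" "y = styl_map A v" "z = styl_map A w"
      using P by (auto simp: J_order_def)
    have "factor_le (card A) (map idx u) (map idx w)"
      using xyz unfolding eq J_order_styl_map[OF w(1,2)] J_order_styl_map[OF w(2,3)]
      by (rule factor_le_trans)
    then show "(x, z) \<in> ?r" unfolding eq J_order_styl_map[OF w(1,3)] .
  qed
  have word_leI: "(styl_map A (s @ v @ t), styl_map A v) \<in> ?r"
    if "s \<in> lists A" "v \<in> lists A" "t \<in> lists A" for s v t
  proof -
    have "s @ v @ t \<in> lists A" using that by simp
    moreover have "factor_le (card A) (map idx (s @ v @ t)) (map idx v)"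
      using that word_letters by (intro factor_leI[of "map idx s" _ "map idx t"]) auto
    ultimately show ?thesis using that J_order_styl_map by blast
  qed
  have one: "styl_map A [] \<in> ?P" by (simp add: P)
  \<comment> \<open>The zero is found as an element with the most boxes: a product with it cannot
    have more, hence equals it and lies below every factor.\<close>
  have "Max (h ` ?P) \<in> h ` ?P" using fin one by (intro Max_in) auto
  then obtain z where z: "z \<in> ?P" "h z = Max (h ` ?P)" by force
  then obtain v where v: "v \<in> lists A" "z = styl_map A v" using P by auto
  have bot: "(z, x) \<in> ?r" if x: "x \<in> ?P" for x
  proof -
    obtain u where u: "u \<in> lists A" "x = styl_map A u" using x P by auto
    let ?m = "styl_map A (u @ v)"
    have "(?m, z) \<in> ?r" using word_leI[of u v "[]"] u v by simp
    moreover have "h ?m \<le> h z" unfolding z(2) using fin u v P by (intro Max_ge) auto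
    ultimately have "?m = z" using less[of ?m z] by fastforce
    then show ?thesis using word_leI[of "[]" u v] u v by simp
  qed
  have top: "(x, styl_map A []) \<in> ?r" if "x \<in> ?P" for x
    using that word_leI[of _ "[]" "[]"] P by auto
  have refl: "(x, x) \<in> ?r" if "x \<in> ?P" for x
    using that word_leI[of "[]" _ "[]"] P by auto
  have cover: "h x = Suc (h y)" if xy: "x \<in> ?P" "y \<in> ?P" "covers ?P ?r y x" for x y
  proof -
    obtain u v where w: "u \<in> lists A" "v \<in> lists A" and eq: "x = styl_map A u" "y = styl_map A v"
      using xy(1,2) P by blast
    show ?thesis using styl_map_cover_boxes[OF w] xy(3) unfolding eq h[OF w(1)] h[OF w(2)] .
  qed
  have sub: "?r \<subseteq> ?P \<times> ?P" by (auto simp: J_order_def)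
  have h_one: "h (styl_map A []) = 0" using h[of "[]"] by (simp add: N_tableau_def num_boxes_def)
  show ?thesis
  proof (intro conjI ballI)
    show "graded_poset ?P ?r"
      by (rule graded_by_height(1)[where h = h and z = z and e = "styl_map A []"])
        (assumption | rule fin sub refl trans less cover z(1) bot one top h_one)+
    fix w assume w: "w \<in> lists A"
    then have "styl_map A w \<in> ?P" by (simp add: P)
    then have "corank ?P ?r (styl_map A w) = int (h (styl_map A w))"
      by (intro graded_by_height(2)[where h = h and z = z and e = "styl_map A []"])
        (assumption | rule fin sub refl trans less cover z(1) bot one top h_one)+
    then show "corank ?P ?r (styl_map A w) = int (num_boxes (N_tableau w))"
      by (simp only: h[OF w])
  qed
qed

end
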